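(* Let $W$ be a Weyl group with (reduced crystallographic) root system $\Phi$, let $T$ be its set of reflections, and let $k$ be a field of characteristic $0$. Let $\alpha\mapsto E_1(\alpha)$ and $\alpha\mapsto E_2(\alpha)$ be multiplicative $k$-valued functions on the set of positive roots such that $E_1(\alpha)\neq E_2(\alpha)$ for every positive root $\alpha$. For $\tau\in T$ let $\kappa_\tau\in k$ be a scalar whose value only depends on the length of the positive root $\alpha$ corresponding to $\tau$. Define, for $\tau\in T$ with corresponding positive root $\alpha$, $$p_\tau=\frac{\kappa_\tau E_1(\alpha)}{E_1(\alpha)-E_2(\alpha)},\qquad q_\tau=\frac{\kappa_\tau E_2(\alpha)}{E_1(\alpha)-E_2(\alpha)}.$$ Let $M_\tau$ be the linear operator on $k[W]$ given by $M_\tau(w)=p_\tau\,\tau w$ if $\ell(\tau w)>\ell(w)$ and $M_\tau(w)=q_\tau\,\tau w$ if $\ell(\tau w)<\ell(w)$, for $w\in W$, and let $R_\tau=1+\varepsilon M_\tau$. Then the operators $\{R_\tau\}_{\tau\in T}$ satisfy the Yang-Baxter equations for $W$.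
   Context: $W$ is a Weyl group with root system $\Phi$, set of positive roots $\Phi^+$, simple reflections $S$, length function $\ell$ with respect to $S$; $T=\{wsw^{-1}: w\in W, s\in S\}$ is the set of reflections, in bijection with the positive roots. $k[W]$ denotes the $k$-vector space with basis $W$. $\varepsilon$ is a formal variable, so operators such as $R_\tau$ act on $k[\varepsilon]\otimes k[W]$. A function $E$ on the positive roots is called multiplicative if $E(\alpha+\beta)=E(\alpha)E(\beta)$ whenever $\alpha$, $\beta$ and $\alpha+\beta$ are positive roots (the value $0$ is allowed). A reflection subgroup $W'$ of $W$ is a subgroup generated by a subset of $T$; it corresponds to the root subsystem $\Phi'=\{\alpha\in\Phi: \text{the reflection in }\alpha\text{ lies in }W'\}$ with positive roots $\Phi'\cap\Phi^+$, and its canonical generators are the reflections in the simple roots of this subsystem. $W'$ is a dihedral reflection subgroup if it has exactly two canonical generators. Yang-Baxter equations for $W$: a family $\{R_\tau\}_{\tau\in T}$ of elements of a monoid satisfies them if for every dihedral reflection subgroup $W'$ of $W$ (not only the maximal ones), with canonical generators $a,b$, $$R_aR_{aba}R_{ababa}\cdots R_{bab}R_b=R_bR_{bab}\cdots R_{ababa}R_{aba}R_a,$$ i.e. if $m$ is the order of $ab$ and $t_i=(ab)^{i-1}a$ for $i=1,\dots,m$ (so $t_1=a$, $t_m=b$, and $t_1,\dots,t_m$ are all the reflections in $W'$), then $R_{t_1}R_{t_2}\cdots R_{t_m}=R_{t_m}\cdots R_{t_2}R_{t_1}$. In particular $R_aR_b=R_bR_a$ when $ab=ba$ and $a,b$ are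 distinct reflections that are canonical generators. *)

theory Defs
  imports
    "HOL-Analysis.Linear_Algebra"
    "HOL-Algebra.Bij"
    "HOL-Algebra.Generated_Groups"
    "HOL-Algebra.Multiplicative_Group"
    "HOL-Computational_Algebra.Polynomial"
    "HOL-Library.Poly_Mapping"
begin

section \<open>Root systems and Weyl groups\<close>

definition root_reflection :: "'v::euclidean_space \<Rightarrow> 'v \<Rightarrow> 'v" where
  "root_reflection \<alpha> x = x - (2 * (x \<bullet> \<alpha>) / (\<alpha> \<bullet> \<alpha>)) *\<^sub>R \<alpha>"

text \<open>Reduced crystallographic root systems. The roots are not required to span the ambient
  space, so that root subsystems are root systems in the same space.\<close>

definition root_system :: "'v::euclidean_space set \<Rightarrow> bool" where
  "root_system \<Phi> \<longleftrightarrow>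
     finite \<Phi> \<and> 0 \<notin> \<Phi> \<and>
     (\<forall>\<alpha>\<in>\<Phi>. \<forall>\<beta>\<in>\<Phi>. root_reflection \<alpha> \<beta> \<in> \<Phi>) \<and>
     (\<forall>\<alpha>\<in>\<Phi>. \<forall>\<beta>\<in>\<Phi>. 2 * (\<beta> \<bullet> \<alpha>) / (\<alpha> \<bullet> \<alpha>) \<in> \<int>) \<and>
     (\<forall>\<alpha>\<in>\<Phi>. \<forall>c. c *\<^sub>R \<alpha> \<in> \<Phi> \<longrightarrow> c = 1 \<or> c = -1)"

text \<open>A choice of positive roots: the roots on one side of a hyperplane containing no root.\<close>

definition positive_system :: "'v::euclidean_space set \<Rightarrow> 'v set \<Rightarrow> bool" where
  "positive_system \<Phi> P \<longleftrightarrow>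
     (\<exists>\<gamma>. (\<forall>\<alpha>\<in>\<Phi>. \<gamma> \<bullet> \<alpha> \<noteq> 0) \<and> P = {\<alpha>\<in>\<Phi>. \<gamma> \<bullet> \<alpha> > 0})"

text \<open>The simple roots of a root system with positive roots \<open>P\<close> are the indecomposable
  elements of \<open>P\<close>.\<close>

definition simple_roots :: "'v::euclidean_space set \<Rightarrow> 'v set" where
  "simple_roots P = {\<alpha>\<in>P. \<not> (\<exists>\<beta>\<in>P. \<exists>\<gamma>\<in>P. \<alpha> = \<beta> + \<gamma>)}"

text \<open>All the groups are subgroups of the group of bijections of the ambient space, in which the
  product is composition of maps.\<close>

abbreviation GV :: "('v::euclidean_space \<Rightarrow> 'v) monoid" where
  "GV \<equiv> BijGroup UNIV"

definition weyl_group :: "'v::euclidean_space set \<Rightarrow> ('v \<Rightarrow> 'v) set" where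
  "weyl_group \<Phi> = generate GV (root_reflection ` \<Phi>)"

definition simple_reflections :: "'v::euclidean_space set \<Rightarrow> ('v \<Rightarrow> 'v) set" where
  "simple_reflections P = root_reflection ` simple_roots P"

definition reflections :: "'v::euclidean_space set \<Rightarrow> 'v set \<Rightarrow> ('v \<Rightarrow> 'v) set" where
  "reflections \<Phi> P =
     {w \<otimes>\<^bsub>GV\<^esub> s \<otimes>\<^bsub>GV\<^esub> inv\<^bsub>GV\<^esub> w | w s. w \<in> weyl_group \<Phi> \<and> s \<in> simple_reflections P}"

text \<open>The positive root corresponding to a reflection.\<close>

definition pos_root :: "'v::euclidean_space set \<Rightarrow> ('v \<Rightarrow> 'v) \<Rightarrow> 'v" where
  "pos_root P \<tau> = (THE \<alpha>. \<alpha> \<in> P \<and> root_reflection \<alpha> = \<tau>)"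

definition mprod :: "('m, 'x) monoid_scheme \<Rightarrow> 'm list \<Rightarrow> 'm" where
  "mprod M xs = foldr (\<lambda>x y. x \<otimes>\<^bsub>M\<^esub> y) xs \<one>\<^bsub>M\<^esub>"

definition weyl_length :: "'v::euclidean_space set \<Rightarrow> ('v \<Rightarrow> 'v) \<Rightarrow> nat" where
  "weyl_length P w =
     (LEAST n. \<exists>ss. length ss = n \<and> set ss \<subseteq> simple_reflections P \<and> mprod GV ss = w)"

definition multiplicative_on :: "'v::euclidean_space set \<Rightarrow> ('v \<Rightarrow> 'k::field) \<Rightarrow> bool" where
  "multiplicative_on P E \<longleftrightarrow>
     (\<forall>\<alpha>\<in>P. \<forall>\<beta>\<in>P. \<alpha> + \<beta> \<in> P \<longrightarrow> E (\<alpha> + \<beta>) = E \<alpha> * E \<beta>)"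

section \<open>Reflection subgroups and the Yang-Baxter equations\<close>

definition reflection_subgroup ::
    "'v::euclidean_space set \<Rightarrow> 'v set \<Rightarrow> ('v \<Rightarrow> 'v) set \<Rightarrow> bool" where
  "reflection_subgroup \<Phi> P W' \<longleftrightarrow> (\<exists>X \<subseteq> reflections \<Phi> P. W' = generate GV X)"

definition root_subsystem :: "'v::euclidean_space set \<Rightarrow> ('v \<Rightarrow> 'v) set \<Rightarrow> 'v set" where
  "root_subsystem \<Phi> W' = {\<alpha>\<in>\<Phi>. root_reflection \<alpha> \<in> W'}"

definition canonical_generators ::
    "'v::euclidean_space set \<Rightarrow> 'v set \<Rightarrow> ('v \<Rightarrow> 'v) set \<Rightarrow> ('v \<Rightarrow> 'v) set" where
  "canonical_generators \<Phi> P W' = root_reflection ` simple_roots (root_subsystem \<Phi> W' \<inter> P)"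

definition dihedral_reflection_subgroup ::
    "'v::euclidean_space set \<Rightarrow> 'v set \<Rightarrow> ('v \<Rightarrow> 'v) set \<Rightarrow> bool" where
  "dihedral_reflection_subgroup \<Phi> P W' \<longleftrightarrow>
     reflection_subgroup \<Phi> P W' \<and> card (canonical_generators \<Phi> P W') = 2"

text \<open>The list \<open>a, aba, ababa, \<dots>, b\<close> of the reflections \<open>(ab)\<^sup>i a\<close> for \<open>0 \<le> i < m\<close>, where \<open>m\<close> is
  the order of \<open>ab\<close>.\<close>

definition dihedral_reflections ::
    "('v::euclidean_space \<Rightarrow> 'v) \<Rightarrow> ('v \<Rightarrow> 'v) \<Rightarrow> ('v \<Rightarrow> 'v) list" where
  "dihedral_reflections a b =
     map (\<lambda>i. (a \<otimes>\<^bsub>GV\<^esub> b) [^]\<^bsub>GV\<^esub> i \<otimes>\<^bsub>GV\<^esub> a) [0..<group.ord GV (a \<otimes>\<^bsub>GV\<^esub> b)]"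

definition yang_baxter ::
    "('m, 'x) monoid_scheme \<Rightarrow> 'v::euclidean_space set \<Rightarrow> 'v set \<Rightarrow> (('v \<Rightarrow> 'v) \<Rightarrow> 'm) \<Rightarrow> bool" where
  "yang_baxter M \<Phi> P R \<longleftrightarrow>
     (\<forall>\<tau>\<in>reflections \<Phi> P. R \<tau> \<in> carrier M) \<and>
     (\<forall>W' a b. dihedral_reflection_subgroup \<Phi> P W' \<and> canonical_generators \<Phi> P W' = {a, b} \<longrightarrow>
        mprod M (map R (dihedral_reflections a b)) =
        mprod M (map R (rev (dihedral_reflections a b))))"

section \<open>Operators on the free module over the Weyl group\<close>

text \<open>For a commutative ring \<open>'r\<close>, the free module \<open>'r[X]\<close> is the set of finitely supported
  functions with support in \<open>X\<close>; the basis element of \<open>x \<in> X\<close> is \<open>Poly_Mapping.single x 1\<close>.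
  In particular \<open>k[\<epsilon>] \<otimes> k[X]\<close> is the case \<open>'r = 'k poly\<close>.\<close>

definition free_module :: "'x set \<Rightarrow> ('x \<Rightarrow>\<^sub>0 'r::comm_ring_1) set" where
  "free_module X = {f. Poly_Mapping.keys f \<subseteq> X}"

definition fm_scale :: "'r::comm_ring_1 \<Rightarrow> ('x \<Rightarrow>\<^sub>0 'r) \<Rightarrow> ('x \<Rightarrow>\<^sub>0 'r)" where
  "fm_scale c f = Poly_Mapping.map ((*) c) f"

text \<open>The linear extension of a function given on the basis.\<close>

definition fm_extend :: "('x \<Rightarrow> ('y \<Rightarrow>\<^sub>0 'r::comm_ring_1)) \<Rightarrow> ('x \<Rightarrow>\<^sub>0 'r) \<Rightarrow> ('y \<Rightarrow>\<^sub>0 'r)" where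
  "fm_extend g f = (\<Sum>x\<in>Poly_Mapping.keys f. fm_scale (Poly_Mapping.lookup f x) (g x))"

text \<open>The monoid of linear endomorphisms of \<open>'r[X]\<close>, as extensional functions.\<close>

definition End_monoid :: "'x set \<Rightarrow> (('x \<Rightarrow>\<^sub>0 'r::comm_ring_1) \<Rightarrow> ('x \<Rightarrow>\<^sub>0 'r)) monoid" where
  "End_monoid X =
     \<lparr>carrier = {F \<in> free_module X \<rightarrow>\<^sub>E free_module X.
        (\<forall>f\<in>free_module X. \<forall>g\<in>free_module X. F (f + g) = F f + F g) \<and>
        (\<forall>c. \<forall>f\<in>free_module X. F (fm_scale c f) = fm_scale c (F f))},
      monoid.mult = compose (free_module X),
      monoid.one = (\<lambda>f\<in>free_module X. f)\<rparr>"

text \<open>The operator \<open>M\<^sub>\<tau>\<close>, over an arbitrary ring of coefficients. The case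
  \<open>\<ell>(\<tau> w) = \<ell>(w)\<close> does not occur, since \<open>\<tau>\<close> has determinant \<open>-1\<close>.\<close>

definition mixed_op ::
    "'v::euclidean_space set \<Rightarrow> (('v \<Rightarrow> 'v) \<Rightarrow> 'r::comm_ring_1) \<Rightarrow> (('v \<Rightarrow> 'v) \<Rightarrow> 'r) \<Rightarrow> ('v \<Rightarrow> 'v) \<Rightarrow>
     (('v \<Rightarrow> 'v) \<Rightarrow>\<^sub>0 'r) \<Rightarrow> (('v \<Rightarrow> 'v) \<Rightarrow>\<^sub>0 'r)" where
  "mixed_op P p q \<tau> = fm_extend (\<lambda>w.
     Poly_Mapping.single (\<tau> \<otimes>\<^bsub>GV\<^esub> w)
       (if weyl_length P (\<tau> \<otimes>\<^bsub>GV\<^esub> w) > weyl_length P w then p \<tau> else q \<tau>))"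

text \<open>The operator \<open>R\<^sub>\<tau> = 1 + \<epsilon> M\<^sub>\<tau>\<close> on \<open>k[\<epsilon>] \<otimes> k[W]\<close>: the scalars \<open>p\<^sub>\<tau>, q\<^sub>\<tau> \<in> k\<close> become constant
  polynomials, and \<open>\<epsilon>\<close> is the polynomial variable \<open>[:0, 1:]\<close>.\<close>

definition mixed_R ::
    "'v::euclidean_space set \<Rightarrow> 'v set \<Rightarrow> (('v \<Rightarrow> 'v) \<Rightarrow> 'k::field) \<Rightarrow> (('v \<Rightarrow> 'v) \<Rightarrow> 'k) \<Rightarrow> ('v \<Rightarrow> 'v) \<Rightarrow>
     (('v \<Rightarrow> 'v) \<Rightarrow>\<^sub>0 'k poly) \<Rightarrow> (('v \<Rightarrow> 'v) \<Rightarrow>\<^sub>0 'k poly)" where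
  "mixed_R \<Phi> P p q \<tau> =
     (\<lambda>f\<in>free_module (weyl_group \<Phi>).
        f + fm_scale [:0, 1:] (mixed_op P (\<lambda>\<tau>. [:p \<tau>:]) (\<lambda>\<tau>. [:q \<tau>:]) \<tau> f))"

end

theory Submission
  imports Defs
begin

text \<open>Fix a vector \<open>\<gamma>\<close> that is positive on the positive roots. By the exchange property,
  \<open>\<ell>(s\<^sub>\<alpha> w) > \<ell>(w)\<close> holds for a positive root \<open>\<alpha>\<close> precisely when \<open>w \<gamma> \<bullet> \<alpha> > 0\<close>
  (\<open>weyl_length_reflection_iff\<close>). So the operators \<open>M\<^sub>\<tau>\<close> only see on which side of the wall of \<open>\<tau>\<close> the
  chamber of \<open>w\<close> lies.

  Let \<open>W'\<close> be a dihedral reflection subgroup with canonical generators \<open>a\<close>, \<open>b\<close> and let \<open>m\<close> be the order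
  of \<open>a b\<close>. The operators in its Yang-Baxter equation preserve the span of every coset \<open>W' w\<close>, and each
  coset looks the same. Start from an element of minimal length and multiply it from the left by the
  alternating products of \<open>a\<close> and \<open>b\<close>. This numbers the coset cyclically by \<open>0, \<dots>, 2 m - 1\<close>, such that the
  \<open>i\<close>-th reflection acts by \<open>j \<mapsto> 2 i - 1 - j\<close> and its root is negative precisely on the chambers \<open>j\<close>
  with \<open>i \<le> j < i + m\<close> (\<open>gallery_exists\<close>). Hence \<open>R\<^sub>\<tau>\<close> becomes an explicit operator \<open>chamber_op\<close> on
  functions on \<open>2 m\<close> points (\<open>foldr_mixed_R\<close>). Since \<open>k\<close> is infinite, the formal variable \<open>\<epsilon>\<close> may be
  replaced by an arbitrary scalar.

  The canonical generators are the reflections in two simple roots \<open>\<alpha>\<close>, \<open>\<beta>\<close> of the root subsystem. They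
  form an obtuse angle, so by the bound on the product of Cartan integers they span a system of type
  \<open>A\<^sub>1 \<times> A\<^sub>1\<close>, \<open>A\<^sub>2\<close>, \<open>B\<^sub>2\<close> or \<open>G\<^sub>2\<close> (\<open>obtuse_yang_baxter\<close>), in which all roots are known combinations of \<open>\<alpha>\<close> and
  \<open>\<beta>\<close>. Each root that is not simple is a sum of two others, so multiplicativity expresses all weights
  by the values of \<open>E\<^sub>1\<close> and \<open>E\<^sub>2\<close> at \<open>\<alpha>\<close> and \<open>\<beta>\<close> and the two values of \<open>\<kappa>\<close>. What remains is an equality of
  matrices of size \<open>2 m \<le> 12\<close> whose entries are rational functions of these six quantities. It is
  checked entry by entry (\<open>chamber_op_A2\<close>, \<open>chamber_op_B2\<close>, \<open>chamber_op_G2\<close>). Working with \<open>E\<^sub>1\<close> and \<open>E\<^sub>2\<close>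
  separately rather than with their quotient covers the value \<open>0\<close>.\<close>

section \<open>Root systems and the length function\<close>

lemma GV_carrier: "f \<in> carrier GV \<longleftrightarrow> bij f"
  by (simp add: BijGroup_def Bij_def)

lemma GV_mult: "bij f \<Longrightarrow> bij g \<Longrightarrow> f \<otimes>\<^bsub>GV\<^esub> g = f \<circ> g"
  by (simp add: BijGroup_def Bij_def compose_def comp_def restrict_def)

lemma GV_one: "\<one>\<^bsub>GV\<^esub> = id"
  by (simp add: BijGroup_def id_def restrict_def)

lemma GV_inv: "bij f \<Longrightarrow> inv\<^bsub>GV\<^esub> f = inv_into UNIV f"
  by (simp add: inv_BijGroup Bij_def restrict_def)

lemma group_GV: "group GV"
  by (rule group_BijGroup)

lemma root_reflection_add: "root_reflection \<alpha> (x + y) = root_reflection \<alpha> x + root_reflection \<alpha> y"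
  by (simp add: root_reflection_def inner_add_left algebra_simps add_divide_distrib)

lemma root_reflection_scaleR: "root_reflection \<alpha> (c *\<^sub>R x) = c *\<^sub>R root_reflection \<alpha> x"
  by (simp add: root_reflection_def algebra_simps)

lemma root_reflection_self: "\<alpha> \<noteq> 0 \<Longrightarrow> root_reflection \<alpha> \<alpha> = - \<alpha>"
  by (simp add: root_reflection_def algebra_simps scaleR_2)

lemma linear_root_reflection: "linear (root_reflection \<alpha>)"
  by (rule linearI) (simp_all add: root_reflection_add root_reflection_scaleR)

lemma root_reflection_uminus: "root_reflection (- \<alpha>) = root_reflection \<alpha>"
  by (simp add: root_reflection_def fun_eq_iff)

lemma root_reflection_minus: "root_reflection \<alpha> (- x) = - root_reflection \<alpha> x"
  by (simp add: root_reflection_def)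

lemma root_reflection_involution [simp]: "root_reflection \<alpha> (root_reflection \<alpha> x) = x"
  by (cases "\<alpha> = 0") (simp_all add: root_reflection_def inner_diff_left field_simps)

lemma root_reflection_comp_self [simp]: "root_reflection \<alpha> \<circ> root_reflection \<alpha> = id"
  by (simp add: fun_eq_iff)

lemma inner_root_reflection:
  "root_reflection \<alpha> x \<bullet> root_reflection \<alpha> y = x \<bullet> y"
  by (cases "\<alpha> = 0")
    (simp_all add: root_reflection_def inner_diff_left inner_diff_right inner_commute field_simps)

lemma orthogonal_root_reflection: "orthogonal_transformation (root_reflection \<alpha>)"
  by (simp add: orthogonal_transformation_def linear_root_reflection inner_root_reflection)

lemma bij_root_reflection [simp]: "bij (root_reflection \<alpha>)"
  by (rule o_bij[OF root_reflection_comp_self root_reflection_comp_self])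

lemma root_reflection_conjugate:
  assumes "orthogonal_transformation w"
  shows "w (root_reflection \<alpha> x) = root_reflection (w \<alpha>) (w x)"
proof -
  have "linear w" using assms by (simp add: orthogonal_transformation_def)
  moreover have "w a \<bullet> w b = a \<bullet> b" for a b
    using assms by (simp add: orthogonal_transformation_def)
  ultimately show ?thesis
    by (simp add: root_reflection_def linear_diff linear_scale)
qed

lemma root_system_nonzero: "root_system \<Phi> \<Longrightarrow> \<alpha> \<in> \<Phi> \<Longrightarrow> \<alpha> \<noteq> 0"
  by (auto simp: root_system_def)

lemma root_system_reflection:
  "root_system \<Phi> \<Longrightarrow> \<alpha> \<in> \<Phi> \<Longrightarrow> \<beta> \<in> \<Phi> \<Longrightarrow> root_reflection \<alpha> \<beta> \<in> \<Phi>"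
  by (simp add: root_system_def)

lemma root_system_uminus: "root_system \<Phi> \<Longrightarrow> \<alpha> \<in> \<Phi> \<Longrightarrow> - \<alpha> \<in> \<Phi>"
  using root_system_reflection[of \<Phi> \<alpha> \<alpha>] root_reflection_self[of \<alpha>] root_system_nonzero[of \<Phi> \<alpha>]
  by simp

lemma root_system_cartan_int:
  assumes "root_system \<Phi>" "\<alpha> \<in> \<Phi>" "\<beta> \<in> \<Phi>"
  obtains n :: int where "2 * (\<beta> \<bullet> \<alpha>) / (\<alpha> \<bullet> \<alpha>) = of_int n"
  using assms unfolding root_system_def by (metis Ints_cases)

lemma root_system_parallel:
  assumes "root_system \<Phi>" "\<alpha> \<in> \<Phi>" "\<beta> \<in> \<Phi>" "\<beta> = c *\<^sub>R \<alpha>"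
  shows "\<beta> = \<alpha> \<or> \<beta> = - \<alpha>"
proof -
  have "c = 1 \<or> c = -1" using assms unfolding root_system_def by blast
  with assms(4) show ?thesis by auto
qed

text \<open>The strict Cauchy-Schwarz inequality: equality would make \<open>\<beta>\<close> a multiple of \<open>\<alpha>\<close>, and the system
  is reduced.\<close>

lemma root_system_inner_less:
  assumes "root_system \<Phi>" "\<alpha> \<in> \<Phi>" "\<beta> \<in> \<Phi>" "\<beta> \<noteq> \<alpha>" "\<beta> \<noteq> - \<alpha>"
  shows "(\<alpha> \<bullet> \<beta>) * (\<alpha> \<bullet> \<beta>) < (\<alpha> \<bullet> \<alpha>) * (\<beta> \<bullet> \<beta>)"
proof -
  have a: "\<alpha> \<bullet> \<alpha> > 0" using root_system_nonzero[OF assms(1,2)] by simp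
  define c where "c = (\<alpha> \<bullet> \<beta>) / (\<alpha> \<bullet> \<alpha>)"
  have "\<beta> \<noteq> c *\<^sub>R \<alpha>" using root_system_parallel[OF assms(1-3)] assms(4,5) by blast
  then have "0 < (\<beta> - c *\<^sub>R \<alpha>) \<bullet> (\<beta> - c *\<^sub>R \<alpha>)" by simp
  also have "\<dots> = \<beta> \<bullet> \<beta> - (\<alpha> \<bullet> \<beta>) * (\<alpha> \<bullet> \<beta>) / (\<alpha> \<bullet> \<alpha>)"
    using a by (simp add: c_def inner_diff_left inner_diff_right inner_commute field_simps)
  finally show ?thesis using a by (simp add: field_simps)
qed

text \<open>The product of the two Cartan integers is four times the squared cosine of the angle, so it is
  less than four. All finiteness in rank two comes from this bound.\<close>

lemma root_system_cartan_product:
  assumes \<Phi>: "root_system \<Phi>" "\<alpha> \<in> \<Phi>" "\<beta> \<in> \<Phi>" and neq: "\<beta> \<noteq> \<alpha>" "\<beta> \<noteq> - \<alpha>"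
    and n: "2 * (\<beta> \<bullet> \<alpha>) / (\<alpha> \<bullet> \<alpha>) = of_int n" and n': "2 * (\<alpha> \<bullet> \<beta>) / (\<beta> \<bullet> \<beta>) = of_int n'"
  shows "n * n' \<le> 3"
proof -
  have pos: "\<alpha> \<bullet> \<alpha> > 0" "\<beta> \<bullet> \<beta> > 0" using root_system_nonzero[OF \<Phi>(1)] \<Phi> by simp_all
  have "real_of_int (n * n') = 4 * ((\<alpha> \<bullet> \<beta>) * (\<alpha> \<bullet> \<beta>)) / ((\<alpha> \<bullet> \<alpha>) * (\<beta> \<bullet> \<beta>))"
    unfolding of_int_mult n[symmetric] n'[symmetric] by (simp add: inner_commute)
  also have "\<dots> < 4"
    using root_system_inner_less[OF \<Phi> neq] pos by (simp add: divide_less_eq)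
  finally show ?thesis by linarith
qed

text \<open>At an acute angle both Cartan integers are positive with product at most three, so one of them
  is one, and the corresponding reflection sends one root to plus or minus the difference.\<close>

lemma root_system_diff:
  assumes \<Phi>: "root_system \<Phi>" "\<alpha> \<in> \<Phi>" "\<beta> \<in> \<Phi>" and "\<alpha> \<bullet> \<beta> > 0" "\<alpha> \<noteq> \<beta>"
  shows "\<alpha> - \<beta> \<in> \<Phi>"
proof -
  have pos: "\<alpha> \<bullet> \<alpha> > 0" "\<beta> \<bullet> \<beta> > 0" using root_system_nonzero[OF \<Phi>(1)] \<Phi> by simp_all
  obtain n n' where n: "2 * (\<beta> \<bullet> \<alpha>) / (\<alpha> \<bullet> \<alpha>) = of_int n" and n': "2 * (\<alpha> \<bullet> \<beta>) / (\<beta> \<bullet> \<beta>) = of_int n'"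
    using root_system_cartan_int \<Phi> by meson
  have "\<beta> \<noteq> - \<alpha>" using assms(4) pos(1) by fastforce
  then have "n * n' \<le> 3"
    using root_system_cartan_product[OF \<Phi> _ _ n n'] assms(5) by blast
  moreover have "real_of_int n > 0" "real_of_int n' > 0"
    unfolding n[symmetric] n'[symmetric] using assms(4) pos by (simp_all add: inner_commute)
  then have "n \<ge> 1" "n' \<ge> 1" by linarith+
  moreover have "4 \<le> n * n'" if "n \<ge> 2" "n' \<ge> 2" using mult_mono[OF that] that by simp
  ultimately consider "n = 1" | "n' = 1" by force
  then show ?thesis
  proof cases
    case 1
    then have "root_reflection \<alpha> \<beta> = \<beta> - \<alpha>" unfolding root_reflection_def n by simp
    then have "\<beta> - \<alpha> \<in> \<Phi>" using root_system_reflection \<Phi> by metis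
    then show ?thesis using root_system_uminus[OF \<Phi>(1)] by force
  next
    case 2
    then have "root_reflection \<beta> \<alpha> = \<alpha> - \<beta>" unfolding root_reflection_def n' by simp
    then show ?thesis using root_system_reflection \<Phi> by metis
  qed
qed

text \<open>A positive system together with a vector \<open>\<gamma>\<close> that defines it. Keeping \<open>\<gamma>\<close> pays off: the inverse
  of \<open>w\<close> sends \<open>\<alpha>\<close> to a positive root precisely when \<open>w \<gamma> \<bullet> \<alpha> > 0\<close>, so an element \<open>w\<close> of the Weyl
  group can be thought of as the chamber that contains the point \<open>w \<gamma>\<close>.\<close>

locale positive_roots =
  fixes \<Phi> P :: "'v::euclidean_space set" and \<gamma> :: 'v
  assumes \<Phi>: "root_system \<Phi>"
    and regular: "\<alpha> \<in> \<Phi> \<Longrightarrow> \<gamma> \<bullet> \<alpha> \<noteq> 0"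
    and P_def: "P = {\<alpha> \<in> \<Phi>. \<gamma> \<bullet> \<alpha> > 0}"
begin

lemma P_\<Phi>: "\<alpha> \<in> P \<Longrightarrow> \<alpha> \<in> \<Phi>" and P_pos: "\<alpha> \<in> P \<Longrightarrow> \<gamma> \<bullet> \<alpha> > 0"
  by (simp_all add: P_def)

lemma finite_P: "finite P"
  using \<Phi> by (simp add: P_def root_system_def)

lemma uminus_P: "\<alpha> \<in> \<Phi> \<Longrightarrow> \<alpha> \<notin> P \<Longrightarrow> - \<alpha> \<in> P"
  using regular[of \<alpha>] root_system_uminus[OF \<Phi>, of \<alpha>] by (auto simp: P_def)

lemma uminus_notin_P: "\<alpha> \<in> P \<Longrightarrow> - \<alpha> \<notin> P"
  by (auto simp: P_def)

lemma simple_P: "\<alpha> \<in> simple_roots P \<Longrightarrow> \<alpha> \<in> P"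
  by (simp add: simple_roots_def)

lemma simple_indecomposable: "\<alpha> \<in> simple_roots P \<Longrightarrow> \<beta> \<in> P \<Longrightarrow> \<delta> \<in> P \<Longrightarrow> \<alpha> \<noteq> \<beta> + \<delta>"
  by (auto simp: simple_roots_def)

text \<open>Height induction. The height \<open>\<gamma> \<bullet> \<alpha>\<close> is a real number, but it takes finitely many values on \<open>P\<close>.\<close>

lemma P_induct [consumes 1]:
  assumes "\<alpha> \<in> P"
    and step: "\<And>\<alpha>. \<alpha> \<in> P \<Longrightarrow> (\<And>\<beta>. \<beta> \<in> P \<Longrightarrow> \<gamma> \<bullet> \<beta> < \<gamma> \<bullet> \<alpha> \<Longrightarrow> Q \<beta>) \<Longrightarrow> Q \<alpha>"
  shows "Q \<alpha>"
proof -
  define h where "h \<alpha> = card {\<beta> \<in> P. \<gamma> \<bullet> \<beta> < \<gamma> \<bullet> \<alpha>}" for \<alpha>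
  have h: "h \<beta> < h \<alpha>" if "\<beta> \<in> P" "\<gamma> \<bullet> \<beta> < \<gamma> \<bullet> \<alpha>" for \<alpha> \<beta>
    unfolding h_def using finite_P that by (intro psubset_card_mono) auto
  show ?thesis using assms(1)
  proof (induction "h \<alpha>" arbitrary: \<alpha> rule: less_induct)
    case less
    then show ?case using step h by blast
  qed
qed

text \<open>A positive root is a sum of simple roots; this is the form in which that fact is used, and it
  follows by induction on the height without writing the sum down.\<close>

lemma simple_nonpos_imp_nonpos:
  assumes "\<And>\<sigma>. \<sigma> \<in> simple_roots P \<Longrightarrow> v \<bullet> \<sigma> \<le> 0" and "\<alpha> \<in> P"
  shows "v \<bullet> \<alpha> \<le> 0"
  using assms(2)
proof (induction rule: P_induct)
  case (1 \<alpha>)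
  show ?case
  proof (cases "\<alpha> \<in> simple_roots P")
    case False
    then obtain \<beta> \<delta> where *: "\<beta> \<in> P" "\<delta> \<in> P" "\<alpha> = \<beta> + \<delta>"
      using 1(1) by (auto simp: simple_roots_def)
    then show ?thesis using 1(2)[of \<beta>] 1(2)[of \<delta>] P_pos[of \<beta>] P_pos[of \<delta>]
      by (simp add: inner_add_right)
  qed (use assms(1) in blast)
qed

lemma simple_acute:
  assumes "\<alpha> \<in> P"
  obtains \<sigma> where "\<sigma> \<in> simple_roots P" "\<alpha> \<bullet> \<sigma> > 0"
proof -
  have "\<alpha> \<bullet> \<alpha> > 0" using root_system_nonzero[OF \<Phi>] P_\<Phi>[OF assms] by simp
  then show ?thesis using simple_nonpos_imp_nonpos[OF _ assms, of \<alpha>] that by (meson not_le)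
qed

lemma simple_diff:
  assumes "\<alpha> \<in> simple_roots P" "\<beta> \<in> P" "\<beta> \<noteq> \<alpha>" "\<alpha> \<bullet> \<beta> > 0"
  shows "\<beta> - \<alpha> \<in> P"
proof (rule ccontr)
  assume "\<beta> - \<alpha> \<notin> P"
  moreover have "\<beta> - \<alpha> \<in> \<Phi>"
    using root_system_diff[OF \<Phi>, of \<beta> \<alpha>] assms P_\<Phi> simple_P by (simp add: inner_commute)
  ultimately have "\<alpha> - \<beta> \<in> P" using uminus_P by fastforce
  then show False using simple_indecomposable[OF assms(1,2)] by force
qed

lemma simple_obtuse:
  assumes "\<alpha> \<in> simple_roots P" "\<beta> \<in> simple_roots P" "\<alpha> \<noteq> \<beta>"
  shows "\<alpha> \<bullet> \<beta> \<le> 0"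
proof (rule ccontr)
  assume "\<not> \<alpha> \<bullet> \<beta> \<le> 0"
  then have "\<beta> - \<alpha> \<in> P" using simple_diff[of \<alpha> \<beta>] assms simple_P by force
  then show False using simple_indecomposable[OF assms(2) simple_P[OF assms(1)]] by force
qed

text \<open>With indecomposability as the definition of a simple root, linear independence of the simple
  roots is not at hand. Instead, if \<open>s\<^sub>\<alpha> \<beta> = -\<delta>\<close> were negative, then \<open>\<beta> + \<delta> = n \<alpha>\<close> with a positive
  Cartan integer \<open>n \<le> 3\<close>. For \<open>n = 1\<close> this decomposes \<open>\<alpha>\<close>. Otherwise \<open>\<beta> - \<alpha>\<close> and \<open>\<delta> - \<alpha>\<close> are positive
  roots with sum \<open>(n - 2) \<alpha>\<close>, which is impossible for \<open>n = 2\<close> and decomposes \<open>\<alpha>\<close> for \<open>n = 3\<close>.\<close>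

lemma simple_reflection_P:
  assumes \<alpha>: "\<alpha> \<in> simple_roots P" and \<beta>: "\<beta> \<in> P" "\<beta> \<noteq> \<alpha>"
  shows "root_reflection \<alpha> \<beta> \<in> P"
proof (rule ccontr)
  assume neg: "root_reflection \<alpha> \<beta> \<notin> P"
  have \<alpha>\<Phi>: "\<alpha> \<in> \<Phi>" and \<beta>\<Phi>: "\<beta> \<in> \<Phi>" using P_\<Phi> simple_P \<alpha> \<beta> by auto
  define \<delta> where "\<delta> = - root_reflection \<alpha> \<beta>"
  have \<delta>: "\<delta> \<in> P"
    unfolding \<delta>_def using neg root_system_reflection[OF \<Phi> \<alpha>\<Phi> \<beta>\<Phi>] uminus_P by blast
  obtain n n' where n: "2 * (\<beta> \<bullet> \<alpha>) / (\<alpha> \<bullet> \<alpha>) = of_int n" and n': "2 * (\<alpha> \<bullet> \<beta>) / (\<beta> \<bullet> \<beta>) = of_int n'"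
    using root_system_cartan_int[OF \<Phi>] \<alpha>\<Phi> \<beta>\<Phi> by meson
  have sum: "\<beta> + \<delta> = of_int n *\<^sub>R \<alpha>" using n by (simp add: \<delta>_def root_reflection_def)
  have \<alpha>0: "\<alpha> \<noteq> 0" "\<alpha> \<bullet> \<alpha> > 0" "\<beta> \<bullet> \<beta> > 0" using root_system_nonzero[OF \<Phi>] \<alpha>\<Phi> \<beta>\<Phi> by auto
  have "0 < \<gamma> \<bullet> (\<beta> + \<delta>)" using P_pos[OF \<beta>(1)] P_pos[OF \<delta>] by (simp add: inner_add_right)
  then have "0 < of_int n * (\<gamma> \<bullet> \<alpha>)" unfolding sum by simp
  then have npos: "0 < real_of_int n" using P_pos[OF simple_P[OF \<alpha>]] by (simp add: zero_less_mult_iff)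
  have "n \<noteq> 1" using sum simple_indecomposable[OF \<alpha> \<beta>(1) \<delta>] by auto
  have "\<beta> \<bullet> \<alpha> > 0" using npos \<alpha>0 unfolding n[symmetric] by (simp add: zero_less_divide_iff)
  have "\<delta> \<bullet> \<alpha> = \<beta> \<bullet> \<alpha>"
    using inner_root_reflection[of \<alpha> \<beta> \<alpha>] root_reflection_self[OF \<alpha>0(1)] by (simp add: \<delta>_def)
  moreover have "\<delta> \<noteq> \<alpha>"
  proof
    assume "\<delta> = \<alpha>"
    then have "root_reflection \<alpha> \<beta> = - \<alpha>" by (simp add: \<delta>_def minus_equation_iff)
    then have "root_reflection \<alpha> (root_reflection \<alpha> \<beta>) = \<alpha>"
      by (simp add: root_reflection_minus root_reflection_self[OF \<alpha>0(1)])
    then show False using \<beta>(2) by simp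
  qed
  ultimately have "\<beta> - \<alpha> \<in> P" "\<delta> - \<alpha> \<in> P"
    using simple_diff[OF \<alpha>] \<beta> \<delta> \<open>\<beta> \<bullet> \<alpha> > 0\<close> by (simp_all add: inner_commute)
  moreover have rest: "(\<beta> - \<alpha>) + (\<delta> - \<alpha>) = (of_int n - 2) *\<^sub>R \<alpha>"
    using sum by (simp add: algebra_simps scaleR_2)
  ultimately have "n \<noteq> 3"
    using simple_indecomposable[OF \<alpha>, of "\<beta> - \<alpha>" "\<delta> - \<alpha>"] by auto
  moreover have "0 < \<gamma> \<bullet> ((\<beta> - \<alpha>) + (\<delta> - \<alpha>))"
    using P_pos \<open>\<beta> - \<alpha> \<in> P\<close> \<open>\<delta> - \<alpha> \<in> P\<close> by (simp only: inner_add_right add_pos_pos)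
  then have "n \<noteq> 2" unfolding rest by auto
  moreover have "0 < real_of_int n'"
    unfolding n'[symmetric] using \<open>\<beta> \<bullet> \<alpha> > 0\<close> \<alpha>0 by (simp add: inner_commute)
  moreover have "n * n' \<le> 3"
    using root_system_cartan_product[OF \<Phi> \<alpha>\<Phi> \<beta>\<Phi> _ _ n n'] \<beta> uminus_notin_P simple_P[OF \<alpha>]
    by blast
  moreover have "n * 1 \<le> n * n'" using \<open>0 < real_of_int n'\<close> npos by (intro mult_left_mono) linarith+
  ultimately show False using npos \<open>n \<noteq> 1\<close> by linarith
qed

end

lemma weyl_group_subgroup: "subgroup (weyl_group \<Phi>) GV"
  unfolding weyl_group_def
  by (rule group.generate_is_subgroup[OF group_GV]) (auto simp: GV_carrier)

lemma weyl_group_bij: "w \<in> weyl_group \<Phi> \<Longrightarrow> bij w"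
  using subgroup.mem_carrier[OF weyl_group_subgroup] by (simp add: GV_carrier)

lemma weyl_group_comp: "u \<in> weyl_group \<Phi> \<Longrightarrow> w \<in> weyl_group \<Phi> \<Longrightarrow> u \<circ> w \<in> weyl_group \<Phi>"
  using subgroup.m_closed[OF weyl_group_subgroup] GV_mult[OF weyl_group_bij weyl_group_bij] by metis

lemma weyl_group_id: "id \<in> weyl_group \<Phi>"
  using subgroup.one_closed[OF weyl_group_subgroup] by (simp add: GV_one)

lemma weyl_group_inv: "w \<in> weyl_group \<Phi> \<Longrightarrow> inv_into UNIV w \<in> weyl_group \<Phi>"
  using subgroup.m_inv_closed[OF weyl_group_subgroup] GV_inv[OF weyl_group_bij] by metis

lemma weyl_group_reflection: "\<alpha> \<in> \<Phi> \<Longrightarrow> root_reflection \<alpha> \<in> weyl_group \<Phi>"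
  unfolding weyl_group_def by (rule generate.incl) simp

lemma weyl_group_induct [consumes 1, case_names id refl]:
  assumes "w \<in> weyl_group \<Phi>" and "Q id"
    and "\<And>\<alpha> w. \<alpha> \<in> \<Phi> \<Longrightarrow> w \<in> weyl_group \<Phi> \<Longrightarrow> Q w \<Longrightarrow> Q (root_reflection \<alpha> \<circ> w)"
  shows "Q w"
proof -
  have mem: "w \<in> weyl_group \<Phi>" if "w \<in> generate GV (root_reflection ` \<Phi>)" for w
    using that by (simp add: weyl_group_def)
  have inv_refl: "inv\<^bsub>GV\<^esub> (root_reflection \<alpha>) = root_reflection \<alpha>" for \<alpha> :: 'a
    by (simp add: GV_inv inv_unique_comp)
  have "Q (v \<circ> w)" if "v \<in> generate GV (root_reflection ` \<Phi>)" "w \<in> weyl_group \<Phi>" "Q w" for v w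
    using that
  proof (induction arbitrary: w rule: generate.induct)
    case one
    then show ?case by (simp add: GV_one)
  next
    case (incl h)
    then show ?case using assms(3) by (metis imageE)
  next
    case (inv h)
    then show ?case using assms(3) inv_refl by (metis imageE)
  next
    case (eng h1 h2)
    have "h1 \<otimes>\<^bsub>GV\<^esub> h2 \<circ> w = h1 \<circ> (h2 \<circ> w)"
      using GV_mult[OF weyl_group_bij weyl_group_bij, OF mem mem, OF eng.hyps] by (simp only: comp_assoc)
    moreover have "h2 \<circ> w \<in> weyl_group \<Phi>"
      using weyl_group_comp[OF mem[OF eng.hyps(2)] eng.prems(1)] .
    ultimately show ?case using eng.IH(1)[of "h2 \<circ> w"] eng.IH(2)[of w] eng.prems by (simp only:)
  qed
  from this[OF _ weyl_group_id assms(2)] have "Q (w \<circ> id)" using assms(1) unfolding weyl_group_def by blast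
  then show ?thesis by (simp only: comp_id)
qed

lemma weyl_group_orthogonal: "w \<in> weyl_group \<Phi> \<Longrightarrow> orthogonal_transformation w"
proof (induction rule: weyl_group_induct)
  case id
  show ?case by (simp add: id_def)
next
  case (refl \<alpha> w)
  then show ?case by (intro orthogonal_transformation_compose orthogonal_root_reflection)
qed

lemma weyl_group_root:
  assumes "root_system \<Phi>" "w \<in> weyl_group \<Phi>" "\<alpha> \<in> \<Phi>"
  shows "w \<alpha> \<in> \<Phi>"
  using assms(2,3,1) by (induction rule: weyl_group_induct) (simp_all add: root_system_reflection)

lemma orthogonal_inner_inv:
  assumes "orthogonal_transformation w" "bij w"
  shows "inv_into UNIV w x \<bullet> y = x \<bullet> w y"
proof -
  have "inv_into UNIV w x \<bullet> y = w (inv_into UNIV w x) \<bullet> w y"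
    using assms by (simp add: orthogonal_transformation_def)
  also have "\<dots> = x \<bullet> w y" using assms(2) by (simp add: surj_f_inv_f bij_is_surj)
  finally show ?thesis .
qed

context positive_roots
begin

lemma simple_reflection_weyl: "s \<in> simple_reflections P \<Longrightarrow> s \<in> weyl_group \<Phi>"
  by (auto simp: simple_reflections_def intro!: weyl_group_reflection P_\<Phi> simple_P)

lemma mprod_simple:
  assumes "set ss \<subseteq> simple_reflections P"
  shows "mprod GV ss = foldr (\<circ>) ss id \<and> foldr (\<circ>) ss id \<in> weyl_group \<Phi>"
  using assms
proof (induction ss)
  case Nil
  then show ?case using weyl_group_id by (simp add: mprod_def GV_one id_def)
next
  case (Cons s ss)
  then have "mprod GV ss = foldr (\<circ>) ss id \<and> foldr (\<circ>) ss id \<in> weyl_group \<Phi>"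
    by (meson set_subset_Cons subset_trans)
  then have *: "s \<in> weyl_group \<Phi>" "foldr (\<circ>) ss id \<in> weyl_group \<Phi>" "mprod GV ss = foldr (\<circ>) ss id"
    using Cons.prems simple_reflection_weyl by auto
  moreover have "mprod GV (s # ss) = s \<otimes>\<^bsub>GV\<^esub> mprod GV ss" by (simp add: mprod_def)
  ultimately show ?case
    using weyl_group_comp[OF *(1,2)] GV_mult[OF weyl_group_bij weyl_group_bij, OF *(1,2)]
    by (metis foldr_Cons comp_apply)
qed

definition simple_word :: "('v \<Rightarrow> 'v) \<Rightarrow> ('v \<Rightarrow> 'v) list \<Rightarrow> bool" where
  "simple_word w ss \<longleftrightarrow> set ss \<subseteq> simple_reflections P \<and> foldr (\<circ>) ss id = w"

lemma foldr_comp_append: "foldr (\<circ>) (xs @ ys) id = foldr (\<circ>) xs id \<circ> foldr (\<circ>) ys id"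
  by (induction xs) (simp_all add: comp_assoc)

lemma simple_word_append: "simple_word u xs \<Longrightarrow> simple_word w ys \<Longrightarrow> simple_word (u \<circ> w) (xs @ ys)"
  by (auto simp: simple_word_def foldr_comp_append simp del: foldr_append)

lemma simple_word_reflection: "\<alpha> \<in> simple_roots P \<Longrightarrow> simple_word (root_reflection \<alpha>) [root_reflection \<alpha>]"
  by (simp add: simple_word_def simple_reflections_def)

text \<open>By induction on the height: a positive root that is not simple makes an acute angle with some
  simple root \<open>\<sigma>\<close>, and \<open>s\<^sub>\<sigma>\<close> sends it to a lower positive root. The second conclusion says that simple
  reflections generate the Weyl group.\<close>

lemma positive_root_conjugate_simple:
  assumes "\<alpha> \<in> P"
  shows "\<exists>w\<in>weyl_group \<Phi>. \<exists>\<sigma>\<in>simple_roots P. w \<sigma> = \<alpha> \<and> (\<exists>ss. simple_word (root_reflection \<alpha>) ss)"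
  using assms
proof (induction rule: P_induct)
  case (1 \<alpha>)
  show ?case
  proof (cases "\<alpha> \<in> simple_roots P")
    case True
    then show ?thesis using simple_word_reflection weyl_group_id by (intro bexI[of _ id] bexI[of _ \<alpha>]) auto
  next
    case False
    obtain \<sigma> where \<sigma>: "\<sigma> \<in> simple_roots P" "\<alpha> \<bullet> \<sigma> > 0" using simple_acute[OF 1(1)] .
    have \<sigma>P: "\<sigma> \<in> P" "\<sigma> \<in> \<Phi>" "\<sigma> \<noteq> 0" using \<sigma>(1) simple_P P_\<Phi> root_system_nonzero[OF \<Phi>] by auto
    let ?s = "root_reflection \<sigma>"
    have "?s \<alpha> \<in> P" using simple_reflection_P[OF \<sigma>(1) 1(1)] False \<sigma>(1) by blast
    moreover have "\<gamma> \<bullet> ?s \<alpha> < \<gamma> \<bullet> \<alpha>"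
      using \<sigma>(2) P_pos[OF \<sigma>P(1)] \<sigma>P(3) by (simp add: root_reflection_def inner_diff_right)
    ultimately obtain w \<tau> ss where w: "w \<in> weyl_group \<Phi>" "\<tau> \<in> simple_roots P" "w \<tau> = ?s \<alpha>"
        "simple_word (root_reflection (?s \<alpha>)) ss"
      using 1(2) by blast
    have "?s \<circ> root_reflection (?s \<alpha>) \<circ> ?s = root_reflection \<alpha>"
      using root_reflection_conjugate[OF orthogonal_root_reflection, of \<sigma> "?s \<alpha>"] by (simp add: fun_eq_iff)
    then have "simple_word (root_reflection \<alpha>) (([?s] @ ss) @ [?s])"
      using simple_word_append[OF simple_word_append[OF simple_word_reflection[OF \<sigma>(1)] w(4)]
          simple_word_reflection[OF \<sigma>(1)]] by simp
    moreover have "(?s \<circ> w) \<tau> = \<alpha>" using w(3) by simp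
    moreover have "?s \<circ> w \<in> weyl_group \<Phi>" using weyl_group_comp weyl_group_reflection \<sigma>P(2) w(1) by blast
    ultimately show ?thesis using w(2) by blast
  qed
qed

lemma simple_word_exists:
  assumes "w \<in> weyl_group \<Phi>"
  shows "\<exists>ss. simple_word w ss"
  using assms
proof (induction rule: weyl_group_induct)
  case id
  show ?case by (rule exI[of _ "[]"]) (simp add: simple_word_def id_def)
next
  case (refl \<alpha> w)
  have "\<alpha> \<in> P \<or> - \<alpha> \<in> P" using uminus_P refl(1) by blast
  then have "\<exists>ss. simple_word (root_reflection \<alpha>) ss"
    using positive_root_conjugate_simple root_reflection_uminus by metis
  then show ?case using refl(3) simple_word_append by blast
qed

lemma root_reflection_inj:
  assumes "\<alpha> \<in> P" "\<beta> \<in> P" "root_reflection \<alpha> = root_reflection \<beta>"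
  shows "\<alpha> = \<beta>"
proof -
  have nz: "\<alpha> \<noteq> 0" "\<beta> \<noteq> 0" using assms P_\<Phi> root_system_nonzero[OF \<Phi>] by auto
  have "root_reflection \<beta> \<alpha> = - \<alpha>" using assms(3) root_reflection_self[OF nz(1)] by metis
  then have "\<alpha> - (2 * (\<alpha> \<bullet> \<beta>) / (\<beta> \<bullet> \<beta>)) *\<^sub>R \<beta> = - \<alpha>" by (simp add: root_reflection_def)
  then have "2 *\<^sub>R \<alpha> = (2 * (\<alpha> \<bullet> \<beta>) / (\<beta> \<bullet> \<beta>)) *\<^sub>R \<beta>"
    by (simp add: scaleR_2 algebra_simps)
  then have "(1/2) *\<^sub>R (2 *\<^sub>R \<alpha>) = (1/2) *\<^sub>R ((2 * (\<alpha> \<bullet> \<beta>) / (\<beta> \<bullet> \<beta>)) *\<^sub>R \<beta>)"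
    by (rule arg_cong)
  then have "\<alpha> = ((\<alpha> \<bullet> \<beta>) / (\<beta> \<bullet> \<beta>)) *\<^sub>R \<beta>" by simp
  then show ?thesis
    using root_system_parallel[OF \<Phi>, of \<beta> \<alpha>] assms P_\<Phi> uminus_notin_P by metis
qed

lemma pos_root_reflection: "\<alpha> \<in> P \<Longrightarrow> pos_root P (root_reflection \<alpha>) = \<alpha>"
  unfolding pos_root_def using root_reflection_inj by blast

lemma reflections_eq: "reflections \<Phi> P = root_reflection ` P"
proof -
  have *: "w \<otimes>\<^bsub>GV\<^esub> root_reflection \<sigma> \<otimes>\<^bsub>GV\<^esub> inv\<^bsub>GV\<^esub> w = root_reflection (w \<sigma>)" if "w \<in> weyl_group \<Phi>" for w \<sigma>
  proof -
    have "bij w" using that by (rule weyl_group_bij)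
    then show ?thesis
      using root_reflection_conjugate[OF weyl_group_orthogonal[OF that]]
      by (simp add: GV_mult GV_inv bij_comp bij_imp_bij_inv fun_eq_iff surj_f_inv_f bij_is_surj)
  qed
  show ?thesis
  proof
    show "reflections \<Phi> P \<subseteq> root_reflection ` P"
    proof
      fix t assume "t \<in> reflections \<Phi> P"
      then obtain w \<sigma> where w: "w \<in> weyl_group \<Phi>" "\<sigma> \<in> simple_roots P" and t: "t = root_reflection (w \<sigma>)"
        using * by (auto simp: reflections_def simple_reflections_def)
      have "w \<sigma> \<in> \<Phi>" using w weyl_group_root[OF \<Phi>] simple_P P_\<Phi> by blast
      then show "t \<in> root_reflection ` P"
        unfolding t using uminus_P root_reflection_uminus by (metis imageI)
    qed
  next
    show "root_reflection ` P \<subseteq> reflections \<Phi> P"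
    proof clarify
      fix \<alpha> assume "\<alpha> \<in> P"
      then obtain w \<sigma> where "w \<in> weyl_group \<Phi>" "\<sigma> \<in> simple_roots P" "w \<sigma> = \<alpha>"
        using positive_root_conjugate_simple by blast
      then show "root_reflection \<alpha> \<in> reflections \<Phi> P"
        unfolding reflections_def simple_reflections_def using *[of w \<sigma>] by (metis (mono_tags, lifting) imageI mem_Collect_eq)
    qed
  qed
qed

lemma weyl_length_eq: "weyl_length P w = (LEAST n. \<exists>ss. length ss = n \<and> simple_word w ss)"
proof -
  have "(set ss \<subseteq> simple_reflections P \<and> mprod GV ss = w) \<longleftrightarrow> simple_word w ss" for ss
    using mprod_simple[of ss] by (auto simp: simple_word_def)
  then show ?thesis by (simp add: weyl_length_def)
qed

lemma weyl_length_le: "simple_word w ss \<Longrightarrow> weyl_length P w \<le> length ss"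
  unfolding weyl_length_eq by (rule Least_le) blast

lemma weyl_length_word:
  assumes "w \<in> weyl_group \<Phi>"
  obtains ss where "simple_word w ss" "length ss = weyl_length P w"
proof -
  have "\<exists>n ss. length ss = n \<and> simple_word w ss" using simple_word_exists[OF assms] by blast
  from LeastI_ex[OF this] have "\<exists>ss. length ss = weyl_length P w \<and> simple_word w ss"
    by (simp add: weyl_length_eq)
  then show ?thesis using that by blast
qed

text \<open>The exchange property. The word \<open>ss\<close> describes a walk from the fundamental chamber to that of
  \<open>w\<close>; a walk that ends on the negative side of the wall \<open>\<alpha>\<close> has crossed it, and reflecting the part
  of the walk behind the crossing saves a letter.\<close>

lemma exchange_property:
  assumes "\<alpha> \<in> P" "simple_word w ss" "(w \<gamma>) \<bullet> \<alpha> < 0"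
  shows "\<exists>ts. simple_word (root_reflection \<alpha> \<circ> w) ts \<and> length ts < length ss"
  using assms
proof (induction ss arbitrary: \<alpha> w)
  case Nil
  then show ?case using P_pos by (force simp: simple_word_def)
next
  case (Cons s ss)
  then obtain \<sigma> where \<sigma>: "\<sigma> \<in> simple_roots P" and s: "s = root_reflection \<sigma>"
    by (auto simp: simple_word_def simple_reflections_def)
  define v where "v = foldr (\<circ>) ss id"
  have v: "simple_word v ss" "w = s \<circ> v" using Cons.prems by (auto simp: simple_word_def v_def)
  show ?case
  proof (cases "\<alpha> = \<sigma>")
    case True
    then have "root_reflection \<alpha> \<circ> w = v" by (simp add: v s fun_eq_iff)
    then show ?thesis using v(1) by (metis length_Cons lessI)
  next
    case False
    then have "s \<alpha> \<in> P" using simple_reflection_P \<sigma> Cons.prems(1) s by blast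
    moreover have "(v \<gamma>) \<bullet> s \<alpha> < 0"
      using Cons.prems(3) inner_root_reflection[of \<sigma> "s (v \<gamma>)" \<alpha>] by (simp add: v s)
    ultimately obtain ts where ts: "simple_word (root_reflection (s \<alpha>) \<circ> v) ts" "length ts < length ss"
      using Cons.IH v(1) by blast
    have "s \<circ> (root_reflection (s \<alpha>) \<circ> v) = root_reflection \<alpha> \<circ> w"
      using root_reflection_conjugate[OF orthogonal_root_reflection, of \<sigma> "s \<alpha>"] by (simp add: v s fun_eq_iff)
    then have "simple_word (root_reflection \<alpha> \<circ> w) ([s] @ ts)"
      using simple_word_append[OF simple_word_reflection[OF \<sigma>] ts(1)] s by simp
    then show ?thesis using ts(2) by fastforce
  qed
qed

lemma inner_weyl_nonzero:
  assumes "w \<in> weyl_group \<Phi>" "\<alpha> \<in> \<Phi>"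
  shows "(w \<gamma>) \<bullet> \<alpha> \<noteq> 0"
proof -
  have "inv_into UNIV w \<alpha> \<in> \<Phi>" using weyl_group_root[OF \<Phi> weyl_group_inv] assms by blast
  moreover have "(w \<gamma>) \<bullet> \<alpha> = \<gamma> \<bullet> inv_into UNIV w \<alpha>"
    using orthogonal_inner_inv[OF weyl_group_orthogonal weyl_group_bij, OF assms(1) assms(1), of \<alpha> \<gamma>] by (simp add: inner_commute)
  ultimately show ?thesis using regular by simp
qed

lemma weyl_length_reflection_less:
  assumes "w \<in> weyl_group \<Phi>" "\<alpha> \<in> P" "(w \<gamma>) \<bullet> \<alpha> < 0"
  shows "weyl_length P (root_reflection \<alpha> \<circ> w) < weyl_length P w"
proof -
  obtain ss where "simple_word w ss" "length ss = weyl_length P w"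
    using weyl_length_word[OF assms(1)] .
  then obtain ts where "simple_word (root_reflection \<alpha> \<circ> w) ts" "length ts < weyl_length P w"
    using exchange_property[OF assms(2) \<open>simple_word w ss\<close> assms(3)] by auto
  then show ?thesis using weyl_length_le by (meson le_less_trans)
qed

text \<open>The comparison of lengths in the definition of \<open>M\<^sub>\<tau>\<close> is the question on which side of the wall
  of \<open>\<tau>\<close> the chamber of \<open>w\<close> lies.\<close>

lemma weyl_length_reflection_iff:
  assumes "w \<in> weyl_group \<Phi>" "\<alpha> \<in> P"
  shows "weyl_length P w < weyl_length P (root_reflection \<alpha> \<circ> w) \<longleftrightarrow> (w \<gamma>) \<bullet> \<alpha> > 0"
proof (cases "(w \<gamma>) \<bullet> \<alpha> > 0")
  case True
  let ?s = "root_reflection \<alpha>"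
  have nz: "\<alpha> \<noteq> 0" using assms(2) P_\<Phi> root_system_nonzero[OF \<Phi>] by blast
  have "((?s \<circ> w) \<gamma>) \<bullet> \<alpha> = - ((w \<gamma>) \<bullet> \<alpha>)"
    using inner_root_reflection[of \<alpha> "w \<gamma>"
      "- \<alpha>"] root_reflection_self[OF nz] by (simp add: root_reflection_minus)
  then have "weyl_length P (?s \<circ> (?s \<circ> w)) < weyl_length P (?s \<circ> w)"
    using True assms P_\<Phi> by (intro weyl_length_reflection_less weyl_group_comp weyl_group_reflection) auto
  then show ?thesis using True by (simp flip: comp_assoc)
next
  case False
  then have "(w \<gamma>) \<bullet> \<alpha> < 0" using inner_weyl_nonzero[OF assms(1) P_\<Phi>[OF assms(2)]] by simp
  then show ?thesis using False weyl_length_reflection_less[OF assms] by simp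
qed

end

section \<open>Dihedral groups and galleries\<close>

lemma GV_pow: "bij f \<Longrightarrow> f [^]\<^bsub>GV\<^esub> n = f ^^ n"
proof (induction n)
  case 0
  then show ?case using GV_one monoid.nat_pow_0[OF group.is_monoid[OF group_GV]] by (simp add: id_def)
next
  case (Suc n)
  then show ?case
    using GV_mult[OF bij_fn[OF Suc.prems, of n] Suc.prems] monoid.nat_pow_Suc[OF group.is_monoid[OF group_GV], of f n]
    by (simp only: funpow_Suc_right)
qed

text \<open>The alternating product \<open>a b a \<dots>\<close> with \<open>n\<close> factors. For involutions \<open>a\<close>, \<open>b\<close> whose product has
  order \<open>m\<close>, the first \<open>2 m\<close> of these products list the dihedral group in the cyclic order of its
  chambers. It is written as a power of \<open>a b\<close> times a power of \<open>a\<close> because the reflections in the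
  Yang-Baxter equation have this form, too.\<close>

definition alternating :: "('x \<Rightarrow> 'x) \<Rightarrow> ('x \<Rightarrow> 'x) \<Rightarrow> nat \<Rightarrow> 'x \<Rightarrow> 'x" where
  "alternating a b n = ((a \<circ> b) ^^ (n div 2)) \<circ> (a ^^ (n mod 2))"

locale dihedral_pair =
  fixes a b :: "'x \<Rightarrow> 'x" and m :: nat
  assumes aa: "\<And>x. a (a x) = x" and bb: "\<And>x. b (b x) = x"
    and m: "m > 0" and period: "(a \<circ> b) ^^ m = id"
begin

abbreviation "r \<equiv> a \<circ> b"
abbreviation "alt \<equiv> alternating a b"

lemma pow_mod: "r ^^ (n mod m) = r ^^ n"
  by (metis (no_types) funpow_mod_eq period id_apply fun_eq_iff)

lemma alt_mod: "alt (n mod (2 * m)) = alt n"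
proof -
  have "n mod (2 * m) div 2 = (n div 2) mod m" "n mod (2 * m) mod 2 = n mod 2"
    by (simp_all add: mod_mult2_eq)
  then show ?thesis by (simp only: alternating_def pow_mod)
qed

lemma alt_even: "alt (2 * n) = r ^^ n" and alt_odd: "alt (Suc (2 * n)) = (r ^^ n) \<circ> a"
  by (simp_all add: alternating_def comp_def)

lemma r_a_r: "(r ^^ n) (a ((r ^^ n) x)) = a x"
proof (induction n)
  case (Suc n)
  have "(r ^^ Suc n) y = (r ^^ n) (r y)" for y by (simp only: funpow_Suc_right comp_apply)
  moreover have "(r ^^ Suc n) x = r ((r ^^ n) x)" by simp
  moreover have "r (a (r y)) = a y" for y by (simp add: aa bb)
  ultimately show ?case using Suc by (simp only:)
qed simp

lemma a_pow:
  assumes "n \<le> m"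
  shows "a ((r ^^ n) x) = (r ^^ (m - n)) (a x)"
proof -
  have "(r ^^ (m - n)) ((r ^^ n) (a ((r ^^ n) x))) = (r ^^ (m - n)) (a x)"
    by (simp only: r_a_r)
  moreover have "(r ^^ (m - n)) ((r ^^ n) y) = y" for y
  proof -
    have "(r ^^ (m - n)) ((r ^^ n) y) = (r ^^ (m - n + n)) y" by (simp only: funpow_add comp_apply)
    then show ?thesis using assms period by simp
  qed
  ultimately show ?thesis by simp
qed

text \<open>The key to the combinatorics: in the cyclic numbering of the chambers, the \<open>i\<close>-th reflection is
  the flip \<open>j \<mapsto> 2 i - 1 - j\<close> modulo \<open>2 m\<close>. The summand \<open>2 m\<close> keeps the subtraction in the natural
  numbers.\<close>

lemma reflection_alt:
  assumes "i \<in> {1..m}" "j < 2 * m"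
  shows "((r ^^ (i - 1)) \<circ> a) \<circ> alt j = alt ((2 * i + (2 * m - 1) - j) mod (2 * m))"
proof -
  define l where "l = j div 2"
  have l: "l < m" using assms(2) by (simp add: l_def)
  have add: "(r ^^ (i - 1)) ((r ^^ (m - l)) y) = (r ^^ (i - 1 + (m - l))) y" for y
    by (simp only: funpow_add comp_apply)
  have "((r ^^ (i - 1)) \<circ> a) \<circ> alt j = alt (2 * i + (2 * m - 1) - j)"
  proof (cases "even j")
    case True
    then have j: "j = 2 * l" by (simp add: l_def)
    have "2 * i + (2 * m - 1) - j = Suc (2 * (i - 1 + (m - l)))" using assms(1) l j by auto
    then show ?thesis
      by (simp only: alt_odd alt_even j) (simp only: fun_eq_iff comp_apply a_pow[OF less_imp_le[OF l]] add simp_thms)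
  next
    case False
    then have j: "j = Suc (2 * l)" by (simp add: l_def)
    have "2 * i + (2 * m - 1) - j = 2 * (i - 1 + (m - l))" using assms(1) l j by auto
    then show ?thesis
      by (simp only: alt_odd alt_even j) (simp only: fun_eq_iff comp_apply a_pow[OF less_imp_le[OF l]] add aa simp_thms)
  qed
  then show ?thesis by (simp only: alt_mod)
qed

lemma alt_inverse:
  assumes "j < 2 * m"
  obtains k where "k < 2 * m" "alt k \<circ> alt j = id"
proof (cases "even j")
  case True
  define l where "l = j div 2"
  have j: "j = 2 * l" "l < m" using True assms by (simp_all add: l_def)
  have "alt ((2 * (m - l)) mod (2 * m)) \<circ> alt j = r ^^ (m - l + l)"
    by (simp only: alt_mod alt_even j funpow_add)
  then show ?thesis using that[of "(2 * (m - l)) mod (2 * m)"] m j period by simp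
next
  case False
  define l where "l = j div 2"
  have j: "j = Suc (2 * l)" using False by (simp add: l_def)
  have "alt j \<circ> alt j = id"
    by (simp only: j alt_odd fun_eq_iff comp_apply id_apply r_a_r aa simp_thms)
  then show ?thesis using that assms by blast
qed

lemma last_reflection: "(r ^^ (m - 1)) \<circ> a = b"
proof
  fix x
  have "(r ^^ (m - 1)) (a x) = (r ^^ (m - 1)) (r (b (x)))" by (simp add: bb)
  also have "\<dots> = (r ^^ m) (b x)" using m by (metis Suc_diff_1 funpow_Suc_right comp_apply)
  finally show "((r ^^ (m - 1)) \<circ> a) x = b x" using period by simp
qed

end

lemma ord_root_reflections:
  assumes "f = root_reflection \<alpha> \<circ> root_reflection \<beta>" "f ^^ m = id" "m > 0"
    and "\<And>n. 0 < n \<Longrightarrow> n < m \<Longrightarrow> f ^^ n \<noteq> id"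
  shows "group.ord GV f = m"
proof -
  have f: "bij f" unfolding assms(1) by (simp add: bij_comp)
  then have c: "f \<in> carrier GV" by (simp add: GV_carrier)
  have "group.ord GV f dvd m"
    using group.pow_eq_id[OF group_GV c, of m] GV_pow[OF f] GV_one assms(2) by metis
  then have "group.ord GV f \<le> m" "group.ord GV f > 0" using assms(3) by (auto simp: dvd_imp_le)
  moreover have "f ^^ group.ord GV f = id"
    using group.pow_ord_eq_1[OF group_GV c] GV_pow[OF f] GV_one by metis
  ultimately show ?thesis using assms(4) by (metis le_neq_implies_less)
qed

lemma dihedral_reflections_eq:
  assumes "bij a" "bij b" "group.ord GV (a \<circ> b) = m"
  shows "dihedral_reflections a b = map (\<lambda>i. ((a \<circ> b) ^^ i) \<circ> a) [0..<m]"
  unfolding dihedral_reflections_def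
  by (simp only: GV_mult[OF assms(1,2)] assms(3) GV_pow[OF bij_comp[OF assms(2,1)]]
      GV_mult[OF bij_fn[OF bij_comp[OF assms(2,1)]] assms(1)])

text \<open>The two ways of naming the canonical generators give the two sides of the same equation, so the
  pair of generators may be ordered at will.\<close>

lemma dihedral_reflections_swap:
  assumes "dihedral_pair a b m" "bij a" "bij b" "group.ord GV (a \<circ> b) = m"
  shows "dihedral_reflections b a = rev (dihedral_reflections a b)"
proof -
  interpret dihedral_pair a b m by fact
  have inv: "inv_into UNIV (a \<circ> b) = b \<circ> a"
    by (rule inv_unique_comp) (simp_all add: fun_eq_iff aa bb)
  have ab: "bij (a \<circ> b)" using assms by (simp add: bij_comp)
  have "group.ord GV (b \<circ> a) = m"
    using group.ord_inv[OF group_GV, of "a \<circ> b"] GV_inv[OF ab] inv ab assms(4) by (simp only: GV_carrier)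
  then have "dihedral_reflections b a = map (\<lambda>i. ((b \<circ> a) ^^ i) \<circ> b) [0..<m]"
    using assms dihedral_reflections_eq by blast
  also have "\<dots> = rev (map (\<lambda>i. ((a \<circ> b) ^^ i) \<circ> a) [0..<m])"
  proof (rule nth_equalityI)
    fix i assume "i < length (map (\<lambda>i. ((b \<circ> a) ^^ i) \<circ> b) [0..<m])"
    then have i: "i < m" by simp
    have shift: "((b \<circ> a) ^^ n) (b x) = b ((r ^^ n) x)" for n x
      by (induction n) simp_all
    have "(r ^^ (m - Suc i)) (a x) = ((b \<circ> a) ^^ i) (b x)" for x
    proof -
      have "(r ^^ (m - Suc i)) (a x) = a ((r ^^ Suc i) x)" using a_pow[of "Suc i" x] i by simp
      then show ?thesis by (simp add: aa shift)
    qed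
    then show "map (\<lambda>i. ((b \<circ> a) ^^ i) \<circ> b) [0..<m] ! i = rev (map (\<lambda>i. (r ^^ i) \<circ> a) [0..<m]) ! i"
      using i by (simp add: rev_nth fun_eq_iff)
  qed simp
  finally show ?thesis using dihedral_reflections_eq[OF assms(2-4)] by simp
qed

context positive_roots
begin

text \<open>A closed gallery through the \<open>2 m\<close> chambers of a coset of a dihedral subgroup, with roots
  \<open>\<rho> 1, \<dots>, \<rho> m\<close>. The walls are crossed in this order: \<open>\<rho> i\<close> is positive on chamber \<open>0\<close>, changes sign
  between the chambers \<open>i - 1\<close> and \<open>i\<close>, and changes back between \<open>i + m - 1\<close> and \<open>i + m\<close>.\<close>

definition gallery :: "nat \<Rightarrow> (nat \<Rightarrow> 'v) \<Rightarrow> (nat \<Rightarrow> 'v \<Rightarrow> 'v) \<Rightarrow> bool" where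
  "gallery m \<rho> G \<longleftrightarrow> (\<forall>j<2 * m. G j \<in> weyl_group \<Phi> \<and>
     (\<forall>i\<in>{1..m}. root_reflection (\<rho> i) \<circ> G j = G ((2 * i + (2 * m - 1) - j) mod (2 * m)) \<and>
        (0 < G j \<gamma> \<bullet> \<rho> i \<longleftrightarrow> j < i \<or> i + m \<le> j)))"

text \<open>The gallery starts at an element of minimal length in the coset of \<open>w\<close>; by the length criterion
  its chamber is on the positive side of both generating walls, and the assumption on signs, which
  concerns the dihedral group alone, takes care of the other chambers.\<close>

lemma gallery_exists:
  assumes roots: "\<alpha> \<in> P" "\<beta> \<in> P"
    and pair: "dihedral_pair (root_reflection \<alpha>) (root_reflection \<beta>) m"
    and \<rho>: "\<And>i. i \<in> {1..m} \<Longrightarrow>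
      ((root_reflection \<alpha> \<circ> root_reflection \<beta>) ^^ (i - 1)) \<circ> root_reflection \<alpha> = root_reflection (\<rho> i)"
    and signs: "\<And>y i j. 0 < y \<bullet> \<alpha> \<Longrightarrow> 0 < y \<bullet> \<beta> \<Longrightarrow> i \<in> {1..m} \<Longrightarrow> j < 2 * m \<Longrightarrow>
      0 < alternating (root_reflection \<alpha>) (root_reflection \<beta>) j y \<bullet> \<rho> i \<longleftrightarrow> j < i \<or> i + m \<le> j"
    and w: "w \<in> weyl_group \<Phi>"
  obtains G j where "gallery m \<rho> G" "j < 2 * m" "w = G j"
proof -
  interpret dihedral_pair "root_reflection \<alpha>" "root_reflection \<beta>" m by fact
  have W: "root_reflection \<alpha> \<in> weyl_group \<Phi>" "root_reflection \<beta> \<in> weyl_group \<Phi>"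
    using roots P_\<Phi> weyl_group_reflection by auto
  have pow: "f ^^ n \<in> weyl_group \<Phi>" if "f \<in> weyl_group \<Phi>" for f n
    by (induction n) (use that weyl_group_comp weyl_group_id in \<open>simp_all add: id_def comp_def\<close>)
  have altW: "alt n \<in> weyl_group \<Phi>" for n
    unfolding alternating_def by (intro weyl_group_comp pow W)
  have "0 < 2 * m" using m by simp
  then obtain j0 where j0: "j0 < 2 * m"
    and least: "\<And>j. j < 2 * m \<Longrightarrow> weyl_length P (alt j0 \<circ> w) \<le> weyl_length P (alt j \<circ> w)"
    using ex_has_least_nat[of "\<lambda>j. j < 2 * m" _ "\<lambda>j. weyl_length P (alt j \<circ> w)"] by blast
  define g where "g = alt j0 \<circ> w"
  have g: "g \<in> weyl_group \<Phi>" unfolding g_def using weyl_group_comp altW w by blast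
  \<comment> \<open>Reflecting \<open>g\<close> in a root of the dihedral subgroup stays in the coset, so it cannot shorten \<open>g\<close>.\<close>
  have pos: "0 < g \<gamma> \<bullet> \<delta>"
    if \<delta>: "\<delta> \<in> P" "root_reflection \<delta> = (r ^^ (i - 1)) \<circ> root_reflection \<alpha>" "i \<in> {1..m}" for \<delta> i
  proof -
    have "root_reflection \<delta> \<circ> g = alt ((2 * i + (2 * m - 1) - j0) mod (2 * m)) \<circ> w"
      unfolding g_def \<delta>(2) reflection_alt[OF \<delta>(3) j0, symmetric] by (simp only: comp_assoc)
    then have "weyl_length P g \<le> weyl_length P (root_reflection \<delta> \<circ> g)"
      using least[of "(2 * i + (2 * m - 1) - j0) mod (2 * m)"] m by (simp add: g_def)
    then have "\<not> g \<gamma> \<bullet> \<delta> < 0" using weyl_length_reflection_less[OF g \<delta>(1)] by force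
    then show ?thesis using inner_weyl_nonzero[OF g P_\<Phi>[OF \<delta>(1)]] by simp
  qed
  have posab: "0 < g \<gamma> \<bullet> \<alpha>" "0 < g \<gamma> \<bullet> \<beta>"
    using pos[OF roots(1), of 1] pos[OF roots(2), of m] last_reflection m by (simp_all add: fun_eq_iff)
  obtain k where k: "k < 2 * m" "alt k \<circ> alt j0 = id" using alt_inverse[OF j0] .
  define G where "G j = alt j \<circ> g" for j
  have "alt k \<circ> g = (alt k \<circ> alt j0) \<circ> w" unfolding g_def by (simp only: comp_assoc)
  then have "w = G k" by (simp only: G_def k(2) id_comp)
  moreover have "gallery m \<rho> G"
    unfolding gallery_def
  proof (intro allI impI conjI ballI)
    fix i j assume j: "j < 2 * m"
    show "G j \<in> weyl_group \<Phi>" unfolding G_def using weyl_group_comp altW g by blast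
    assume i: "i \<in> {1..m}"
    show "root_reflection (\<rho> i) \<circ> G j = G ((2 * i + (2 * m - 1) - j) mod (2 * m))"
      unfolding G_def reflection_alt[OF i j, symmetric] \<rho>[OF i] by (simp only: comp_assoc)
    show "(0 < G j \<gamma> \<bullet> \<rho> i) = (j < i \<or> i + m \<le> j)"
      using signs[OF posab i j] by (simp add: G_def)
  qed
  ultimately show ?thesis using that k(1) by blast
qed

end

section \<open>Root systems of rank two\<close>

text \<open>The positive roots \<open>\<rho> 1 = \<alpha>, \<dots>, \<rho> m = \<beta>\<close> of a rank two system in the order in which their
  reflections occur in the Yang-Baxter equation, together with their signs on all chambers when the
  chamber \<open>0\<close> is dominant. The recursion says that \<open>a b\<close> rotates by two walls.\<close>

definition rank_two_roots :: "'v::euclidean_space \<Rightarrow> 'v \<Rightarrow> nat \<Rightarrow> (nat \<Rightarrow> 'v) \<Rightarrow> bool" where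
  "rank_two_roots \<alpha> \<beta> m \<rho> \<longleftrightarrow>
     dihedral_pair (root_reflection \<alpha>) (root_reflection \<beta>) m \<and>
     group.ord GV (root_reflection \<alpha> \<circ> root_reflection \<beta>) = m \<and>
     \<rho> 1 = \<alpha> \<and> \<rho> 2 = root_reflection \<alpha> \<beta> \<and>
     (\<forall>i\<ge>1. i + 2 \<le> m \<longrightarrow> \<rho> (i + 2) = root_reflection \<alpha> (root_reflection \<beta> (\<rho> i))) \<and>
     (\<forall>y. 0 < y \<bullet> \<alpha> \<longrightarrow> 0 < y \<bullet> \<beta> \<longrightarrow> (\<forall>j<2 * m. \<forall>i\<in>{1..m}.
        0 < alternating (root_reflection \<alpha>) (root_reflection \<beta>) j y \<bullet> \<rho> i \<longleftrightarrow> j < i \<or> i + m \<le> j))"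

lemma rank_two_roots_reflection:
  assumes "rank_two_roots \<alpha> \<beta> m \<rho>" "i < m"
  shows "((root_reflection \<alpha> \<circ> root_reflection \<beta>) ^^ i) \<circ> root_reflection \<alpha> = root_reflection (\<rho> (Suc i))"
  using assms(2)
proof (induction i rule: less_induct)
  case (less i)
  let ?a = "root_reflection \<alpha>" and ?b = "root_reflection \<beta>"
  have \<rho>: "\<rho> 1 = \<alpha>" "\<rho> 2 = ?a \<beta>" "\<And>i. i \<ge> 1 \<Longrightarrow> i + 2 \<le> m \<Longrightarrow> \<rho> (i + 2) = ?a (?b (\<rho> i))"
    using assms(1) by (auto simp: rank_two_roots_def)
  have conj: "root_reflection (?a z) x = ?a (root_reflection z (?a x))"
    "root_reflection (?b z) x = ?b (root_reflection z (?b x))" for z x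
    using root_reflection_conjugate[OF orthogonal_root_reflection, of \<alpha> z "?a x"]
      root_reflection_conjugate[OF orthogonal_root_reflection, of \<beta> z "?b x"] by simp_all
  consider "i = 0" | "i = 1" | k where "i = Suc (Suc k)" by (metis One_nat_def not0_implies_Suc)
  then show ?case
  proof cases
    case 1
    then show ?thesis using \<rho>(1) by (simp add: fun_eq_iff)
  next
    case 2
    then show ?thesis using \<rho>(2) by (simp add: fun_eq_iff conj numeral_2_eq_2)
  next
    case 3
    have k: "k < i" "k < m" using 3 less.prems by simp_all
    have IH: "root_reflection (\<rho> (Suc k)) y = ((?a \<circ> ?b) ^^ k) (?a y)" for y
      using fun_cong[OF less.IH[OF k], of y] by (metis comp_apply)
    have "\<rho> (Suc i) = ?a (?b (\<rho> (Suc k)))" using \<rho>(3)[of "Suc k"] less.prems 3 by simp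
    then have "root_reflection (\<rho> (Suc i)) x = (?a \<circ> ?b) (root_reflection (\<rho> (Suc k)) (?b (?a x)))" for x
      by (simp add: conj)
    also have "\<dots> x = (?a \<circ> ?b) (((?a \<circ> ?b) ^^ k) (?a (?b (?a x))))" for x
      by (simp only: IH)
    also have "\<dots> x = (((?a \<circ> ?b) ^^ i) \<circ> ?a) x" for x
      by (simp only: 3 funpow.simps comp_apply funpow_swap1)
    finally show ?thesis by (rule ext[OF sym])
  qed
qed

text \<open>Two roots with Cartan integers \<open>- N\<close> and \<open>- N'\<close>. The vector that is positive on both of them makes
  the signs in the following lemmas non-vacuous, and thereby bounds the order of \<open>a b\<close> from below.\<close>

locale rank_two_pair =
  fixes \<alpha> \<beta> :: "'v::euclidean_space" and N N' :: real
  assumes nonzero: "\<alpha> \<noteq> 0" "\<beta> \<noteq> 0"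
    and cartan: "2 * (\<beta> \<bullet> \<alpha>) / (\<alpha> \<bullet> \<alpha>) = - N" "2 * (\<alpha> \<bullet> \<beta>) / (\<beta> \<bullet> \<beta>) = - N'"
    and dominant: "\<exists>y. 0 < y \<bullet> \<alpha> \<and> 0 < y \<bullet> \<beta>"
begin

abbreviation "a \<equiv> root_reflection \<alpha>"
abbreviation "b \<equiv> root_reflection \<beta>"

definition comb :: "real \<Rightarrow> real \<Rightarrow> 'v" where "comb c d = c *\<^sub>R \<alpha> + d *\<^sub>R \<beta>"

definition f :: "'v \<Rightarrow> 'v" where "f x = a (b x)"

lemma a_comb: "a (comb c d) = comb (d * N - c) d"
  using nonzero cartan(1)
  by (simp add: comb_def root_reflection_add root_reflection_scaleR root_reflection_self)
    (simp add: root_reflection_def algebra_simps)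

lemma b_comb: "b (comb c d) = comb c (c * N' - d)"
  using nonzero cartan(2)
  by (simp add: comb_def root_reflection_add root_reflection_scaleR root_reflection_self)
    (simp add: root_reflection_def algebra_simps)

lemma f_comb: "f (comb c d) = comb (c * (N * N' - 1) - d * N) (c * N' - d)"
  by (simp add: f_def a_comb b_comb algebra_simps)

lemma f_add_comb:
  "f (x + comb c d) = x + comb (c * (N * N' - 1) - d * N - 2 * (x \<bullet> \<alpha>) / (\<alpha> \<bullet> \<alpha>) - N * (2 * (x \<bullet> \<beta>) / (\<beta> \<bullet> \<beta>)))
      (c * N' - d - 2 * (x \<bullet> \<beta>) / (\<beta> \<bullet> \<beta>))"
proof -
  define u v where "u = 2 * (x \<bullet> \<alpha>) / (\<alpha> \<bullet> \<alpha>)" and "v = 2 * (x \<bullet> \<beta>) / (\<beta> \<bullet> \<beta>)"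
  have "b x = x + comb 0 (- v)" by (simp add: root_reflection_def comb_def v_def)
  moreover have "a x = x + comb (- u) 0" by (simp add: root_reflection_def comb_def u_def)
  ultimately have "f x = x + comb (- u) 0 + comb (- v * N) (- v)"
    by (simp add: f_def root_reflection_add a_comb)
  moreover have "f (x + comb c d) = f x + f (comb c d)"
    by (simp add: f_def root_reflection_add)
  ultimately have "f (x + comb c d) =
      x + (comb (- u) 0 + comb (- v * N) (- v) + comb (c * (N * N' - 1) - d * N) (c * N' - d))"
    by (simp add: f_comb add.assoc)
  also have "\<dots> = x + comb (c * (N * N' - 1) - d * N - u - N * v) (c * N' - d - v)"
    by (simp add: comb_def algebra_simps)
  finally show ?thesis by (simp add: u_def v_def)
qed

lemma inner_f_comb: "f z \<bullet> comb c d = z \<bullet> comb (d * N - c) ((d * N - c) * N' - d)"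
proof -
  have "f z \<bullet> comb c d = a (f z) \<bullet> a (comb c d)" by (simp add: inner_root_reflection)
  also have "\<dots> = b z \<bullet> comb (d * N - c) d" by (simp add: f_def a_comb)
  also have "\<dots> = b (b z) \<bullet> b (comb (d * N - c) d)" by (simp only: inner_root_reflection)
  finally show ?thesis by (simp add: b_comb)
qed

lemma inner_a_comb: "a z \<bullet> comb c d = z \<bullet> comb (d * N - c) d"
  using inner_root_reflection[of \<alpha> z "a (comb c d)"] by (simp add: a_comb)

lemma inner_comb: "z \<bullet> comb c d = c * (z \<bullet> \<alpha>) + d * (z \<bullet> \<beta>)"
  by (simp add: comb_def inner_add_right)

lemma comb_eq_self: "comb 1 0 = \<alpha>" "comb 0 1 = \<beta>" by (simp_all add: comb_def)

text \<open>Everything in a rank two system is determined by how \<open>f = a b\<close> acts on coefficient pairs. A power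
  \<open>f ^^ n\<close> with \<open>0 < n < m\<close> is not the identity, because it moves a dominant vector to chamber \<open>2 n\<close>,
  on which some root is negative.\<close>

lemma rank_two_rootsI:
  assumes m: "m > 0"
    and period: "\<And>x. (f ^^ m) (x + comb 0 0) = x + comb 0 0"
    and cd: "c 1 = 1" "d 1 = 0" "c 2 = N" "d 2 = 1"
      "\<And>i. i \<ge> 1 \<Longrightarrow> i + 2 \<le> m \<Longrightarrow> c (i + 2) = c i * (N * N' - 1) - d i * N"
      "\<And>i. i \<ge> 1 \<Longrightarrow> i + 2 \<le> m \<Longrightarrow> d (i + 2) = c i * N' - d i"
    and signs: "\<And>y j i. 0 < y \<bullet> \<alpha> \<Longrightarrow> 0 < y \<bullet> \<beta> \<Longrightarrow> j < 2 * m \<Longrightarrow> i \<in> {1..m} \<Longrightarrow>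
        0 < (f ^^ (j div 2)) ((a ^^ (j mod 2)) y) \<bullet> comb (c i) (d i) \<longleftrightarrow> j < i \<or> i + m \<le> j"
  shows "rank_two_roots \<alpha> \<beta> m (\<lambda>i. comb (c i) (d i))"
proof -
  have f: "f = a \<circ> b" by (simp add: fun_eq_iff f_def)
  have per: "(a \<circ> b) ^^ m = id" unfolding f[symmetric] using period by (simp add: fun_eq_iff comb_def)
  have "f ^^ n \<noteq> id" if "0 < n" "n < m" for n
  proof
    assume n: "f ^^ n = id"
    obtain y where y: "0 < y \<bullet> \<alpha>" "0 < y \<bullet> \<beta>" using dominant by blast
    have "2 * n < i \<or> i + m \<le> 2 * n" if "i \<in> {1..m}" for i
      using signs[OF y, of "2 * n" i] signs[OF y, of 0 i] that \<open>n < m\<close> n by simp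
    \<comment> \<open>The cases \<open>i = 1\<close> and \<open>i = m\<close> contradict each other: the first gives \<open>m < 2 n\<close>, the second
      \<open>2 n < m\<close>.\<close>
    from this[of 1] this[of m] show False using that by simp
  qed
  then have "group.ord GV (a \<circ> b) = m"
    by (intro ord_root_reflections[OF refl per m]) (simp add: f)
  moreover have "a \<beta> = comb N 1" using a_comb[of 0 1] by (simp add: comb_eq_self)
  moreover have "a (b (comb (c i) (d i))) = comb (c i * (N * N' - 1) - d i * N) (c i * N' - d i)" for i
    using f_comb by (simp add: f_def)
  moreover have "dihedral_pair a b m" using per m by (simp add: dihedral_pair_def)
  ultimately show ?thesis
    using cd signs unfolding rank_two_roots_def
    by (simp add: comb_eq_self alternating_def f[symmetric])
qed

end

lemma funpow_numeral_apply: "(h ^^ numeral k) x = h ((h ^^ pred_numeral k) x)"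
  by (simp add: numeral_eq_Suc)

text \<open>The four types. The lists contain the coefficients of \<open>\<rho> 1, \<dots>, \<rho> m\<close> with respect to \<open>\<alpha>\<close> and \<open>\<beta>\<close>; in
  the types \<open>B\<^sub>2\<close> and \<open>G\<^sub>2\<close> the root \<open>\<alpha>\<close> is short.\<close>

lemma rank_two_A1A1:
  assumes "rank_two_pair \<alpha> \<beta> 0 0"
  shows "rank_two_roots \<alpha> \<beta> 2 (\<lambda>i. ([1, 0] ! (i - 1)) *\<^sub>R \<alpha> + ([0, 1] ! (i - 1)) *\<^sub>R \<beta>)"
proof -
  interpret rank_two_pair \<alpha> \<beta> 0 0 by fact
  have "rank_two_roots \<alpha> \<beta> 2 (\<lambda>i. comb ([1, 0] ! (i - 1)) ([0, 1] ! (i - 1)))"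
  proof (rule rank_two_rootsI)
    show "(f ^^ 2) (x + comb 0 0) = x + comb 0 0" for x
      by (simp add: funpow_numeral_apply f_add_comb)
    fix y :: 'a and i j :: nat
    assume y: "0 < y \<bullet> \<alpha>" "0 < y \<bullet> \<beta>" and "j < 2 * 2" "i \<in> {1..2}"
    then have "j \<in> {0, 1, 2, 3}" "i \<in> {1, 2}" by (simp, arith)+
    then show "0 < (f ^^ (j div 2)) ((a ^^ (j mod 2)) y) \<bullet> comb ([1, 0] ! (i - 1)) ([0, 1] ! (i - 1)) \<longleftrightarrow> j < i \<or> i + 2 \<le> j"
      using y
      by (elim insertE emptyE; simp add: funpow_numeral_apply inner_f_comb inner_a_comb; simp add: inner_comb)
  qed auto
  then show ?thesis by (simp add: comb_def)
qed

lemma rank_two_A2: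
  assumes "rank_two_pair \<alpha> \<beta> 1 1"
  shows "rank_two_roots \<alpha> \<beta> 3 (\<lambda>i. ([1, 1, 0] ! (i - 1)) *\<^sub>R \<alpha> + ([0, 1, 1] ! (i - 1)) *\<^sub>R \<beta>)"
proof -
  interpret rank_two_pair \<alpha> \<beta> 1 1 by fact
  have "rank_two_roots \<alpha> \<beta> 3 (\<lambda>i. comb ([1, 1, 0] ! (i - 1)) ([0, 1, 1] ! (i - 1)))"
  proof (rule rank_two_rootsI)
    show "(f ^^ 3) (x + comb 0 0) = x + comb 0 0" for x
      by (simp add: funpow_numeral_apply f_add_comb)
    fix y :: 'a and i j :: nat
    assume y: "0 < y \<bullet> \<alpha>" "0 < y \<bullet> \<beta>" and "j < 2 * 3" "i \<in> {1..3}"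
    then have "j \<in> {0, 1, 2, 3, 4, 5}" "i \<in> {1, 2, 3}" by (simp, arith)+
    then show "0 < (f ^^ (j div 2)) ((a ^^ (j mod 2)) y) \<bullet> comb ([1, 1, 0] ! (i - 1)) ([0, 1, 1] ! (i - 1)) \<longleftrightarrow> j < i \<or> i + 3 \<le> j"
      using y
      by (elim insertE emptyE; simp add: funpow_numeral_apply inner_f_comb inner_a_comb; simp add: inner_comb)
  next
    fix i :: nat
    assume "i \<ge> 1" "i + 2 \<le> 3"
    then have "i \<in> {1}" by (simp, arith?)
    then show "[1, 1, 0] ! (i + 2 - 1) = ([1, 1, 0] ! (i - 1)) * (1 * 1 - 1) - ([0, 1, 1] ! (i - 1)) * (1 :: real)"
      "[0, 1, 1] ! (i + 2 - 1) = ([1, 1, 0] ! (i - 1)) * (1 :: real) - ([0, 1, 1] ! (i - 1))"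
      by auto
  qed auto
  then show ?thesis by (simp add: comb_def)
qed

lemma rank_two_B2:
  assumes "rank_two_pair \<alpha> \<beta> 2 1"
  shows "rank_two_roots \<alpha> \<beta> 4 (\<lambda>i. ([1, 2, 1, 0] ! (i - 1)) *\<^sub>R \<alpha> + ([0, 1, 1, 1] ! (i - 1)) *\<^sub>R \<beta>)"
proof -
  interpret rank_two_pair \<alpha> \<beta> 2 1 by fact
  have "rank_two_roots \<alpha> \<beta> 4 (\<lambda>i. comb ([1, 2, 1, 0] ! (i - 1)) ([0, 1, 1, 1] ! (i - 1)))"
  proof (rule rank_two_rootsI)
    show "(f ^^ 4) (x + comb 0 0) = x + comb 0 0" for x
      by (simp add: funpow_numeral_apply f_add_comb)
    fix y :: 'a and i j :: nat
    assume y: "0 < y \<bullet> \<alpha>" "0 < y \<bullet> \<beta>" and "j < 2 * 4" "i \<in> {1..4}"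
    then have "j \<in> {0, 1, 2, 3, 4, 5, 6, 7}" "i \<in> {1, 2, 3, 4}" by (simp, arith)+
    then show "0 < (f ^^ (j div 2)) ((a ^^ (j mod 2)) y) \<bullet> comb ([1, 2, 1, 0] ! (i - 1)) ([0, 1, 1, 1] ! (i - 1)) \<longleftrightarrow> j < i \<or> i + 4 \<le> j"
      using y
      by (elim insertE emptyE; simp add: funpow_numeral_apply inner_f_comb inner_a_comb; simp add: inner_comb)
  next
    fix i :: nat
    assume "i \<ge> 1" "i + 2 \<le> 4"
    then have "i \<in> {1, 2}" by (simp, arith?)
    then show "[1, 2, 1, 0] ! (i + 2 - 1) = ([1, 2, 1, 0] ! (i - 1)) * (2 * 1 - 1) - ([0, 1, 1, 1] ! (i - 1)) * (2 :: real)"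
      "[0, 1, 1, 1] ! (i + 2 - 1) = ([1, 2, 1, 0] ! (i - 1)) * (1 :: real) - ([0, 1, 1, 1] ! (i - 1))"
      by auto
  qed auto
  then show ?thesis by (simp add: comb_def)
qed

lemma rank_two_G2:
  assumes "rank_two_pair \<alpha> \<beta> 3 1"
  shows "rank_two_roots \<alpha> \<beta> 6 (\<lambda>i. ([1, 3, 2, 3, 1, 0] ! (i - 1)) *\<^sub>R \<alpha> + ([0, 1, 1, 2, 1, 1] ! (i - 1)) *\<^sub>R \<beta>)"
proof -
  interpret rank_two_pair \<alpha> \<beta> 3 1 by fact
  have "rank_two_roots \<alpha> \<beta> 6 (\<lambda>i. comb ([1, 3, 2, 3, 1, 0] ! (i - 1)) ([0, 1, 1, 2, 1, 1] ! (i - 1)))"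
  proof (rule rank_two_rootsI)
    show "(f ^^ 6) (x + comb 0 0) = x + comb 0 0" for x
      by (simp add: funpow_numeral_apply f_add_comb)
    fix y :: 'a and i j :: nat
    assume y: "0 < y \<bullet> \<alpha>" "0 < y \<bullet> \<beta>" and "j < 2 * 6" "i \<in> {1..6}"
    then have "j \<in> {0, 1, 2, 3, 4, 5, 6, 7, 8, 9, 10, 11}" "i \<in> {1, 2, 3, 4, 5, 6}" by (simp, arith)+
    then show "0 < (f ^^ (j div 2)) ((a ^^ (j mod 2)) y) \<bullet> comb ([1, 3, 2, 3, 1, 0] ! (i - 1)) ([0, 1, 1, 2, 1, 1] ! (i - 1)) \<longleftrightarrow> j < i \<or> i + 6 \<le> j"
      using y
      by (elim insertE emptyE; simp add: funpow_numeral_apply inner_f_comb inner_a_comb; simp add: inner_comb)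
  next
    fix i :: nat
    assume "i \<ge> 1" "i + 2 \<le> 6"
    then have "i \<in> {1, 2, 3, 4}" by (simp, arith?)
    then show "[1, 3, 2, 3, 1, 0] ! (i + 2 - 1) = ([1, 3, 2, 3, 1, 0] ! (i - 1)) * (3 * 1 - 1) - ([0, 1, 1, 2, 1, 1] ! (i - 1)) * (3 :: real)"
      "[0, 1, 1, 2, 1, 1] ! (i + 2 - 1) = ([1, 3, 2, 3, 1, 0] ! (i - 1)) * (1 :: real) - ([0, 1, 1, 2, 1, 1] ! (i - 1))"
      by auto
  qed auto
  then show ?thesis by (simp add: comb_def)
qed

section \<open>The Yang-Baxter equation on the chambers of a dihedral group\<close>

text \<open>The operator \<open>R\<^sub>\<tau>\<close> for the \<open>i\<close>-th reflection, read on functions on the \<open>2 m\<close> chambers of a coset.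
  The weight is that of the step from chamber \<open>2 i - 1 - j\<close> to chamber \<open>j\<close>, so it is \<open>q i\<close> when the
  arrival chamber \<open>j\<close> is on the positive side.\<close>

definition chamber_op :: "nat \<Rightarrow> (nat \<Rightarrow> 'k::comm_ring_1) \<Rightarrow> (nat \<Rightarrow> 'k) \<Rightarrow> nat \<Rightarrow> (nat \<Rightarrow> 'k) \<Rightarrow> nat \<Rightarrow> 'k" where
  "chamber_op m p q i F j =
     F j + (if j < i \<or> i + m \<le> j then q i else p i) * F ((2 * i + (2 * m - 1) - j) mod (2 * m))"

text \<open>Linearity: two products of chamber operators agree once they agree on the indicator functions.
  On an indicator function almost all terms vanish, which keeps the identities below small.\<close>

lemma foldr_chamber_op_basis:
  assumes "j < 2 * m"
  shows "foldr (chamber_op m p q) xs F j =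
    (\<Sum>k<2 * m. F k * foldr (chamber_op m p q) xs (\<lambda>l. of_bool (l = k)) j)"
  using assms
proof (induction xs arbitrary: j)
  case Nil
  then show ?case by simp
next
  case (Cons i xs)
  have "(2 * i + (2 * m - 1) - j) mod (2 * m) < 2 * m" using Cons.prems by simp
  with Cons show ?case
    by (simp add: chamber_op_def sum.distrib sum_distrib_left algebra_simps)
qed

lemma chamber_op_eqI:
  assumes "\<And>j k. j < 2 * m \<Longrightarrow> k < 2 * m \<Longrightarrow>
     foldr (chamber_op m p q) xs (\<lambda>l. of_bool (l = k)) j = foldr (chamber_op m p q) ys (\<lambda>l. of_bool (l = k)) j"
    and "j < 2 * m"
  shows "foldr (chamber_op m p q) xs F j = foldr (chamber_op m p q) ys F j"
proof -
  have "foldr (chamber_op m p q) xs F j =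
      (\<Sum>k<2 * m. F k * foldr (chamber_op m p q) xs (\<lambda>l. of_bool (l = k)) j)"
    using assms(2) by (rule foldr_chamber_op_basis)
  also have "\<dots> = (\<Sum>k<2 * m. F k * foldr (chamber_op m p q) ys (\<lambda>l. of_bool (l = k)) j)"
    using assms by simp
  also have "\<dots> = foldr (chamber_op m p q) ys F j"
    using assms(2) by (rule foldr_chamber_op_basis[symmetric])
  finally show ?thesis .
qed

text \<open>The Yang-Baxter equation in the four rank two types. Commuting reflections satisfy it for arbitrary
  weights, because each of them leaves the sign of the other root unchanged.\<close>

lemma chamber_op_A1A1:
  assumes "j < 4"
  shows "foldr (chamber_op 2 p q) [1, 2] F j = foldr (chamber_op 2 p q) [2, 1] F j"
proof -
  have "j = 0 \<or> j = 1 \<or> j = 2 \<or> j = 3" using assms by arith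
  then show ?thesis by (elim disjE; simp add: chamber_op_def algebra_simps)
qed

text \<open>In the other types the weights enter through \<open>A i = E\<^sub>1 (\<rho> i)\<close> and \<open>B i = E\<^sub>2 (\<rho> i)\<close>.
  Multiplicativity expresses them by the values at the two simple roots; with the denominators \<open>e\<^sub>i\<close>
  cleared, each matrix entry is a polynomial identity in these four values and the \<open>\<kappa> i\<close>.\<close>

lemma chamber_op_A2:
  fixes A B p q \<kappa> :: "nat \<Rightarrow> 'k::field"
  assumes p: "\<And>i. i \<in> {1..3} \<Longrightarrow> p i = \<kappa> i * A i / (A i - B i)"
    and q: "\<And>i. i \<in> {1..3} \<Longrightarrow> q i = \<kappa> i * B i / (A i - B i)"
    and neq: "\<And>i. i \<in> {1..3} \<Longrightarrow> A i \<noteq> B i"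
    and \<kappa>: "\<kappa> 2 = \<kappa> 1" "\<kappa> 3 = \<kappa> 1"
    and A: "A 2 = A 1 * A 3" and B: "B 2 = B 1 * B 3"
    and "j < 6"
  shows "foldr (chamber_op 3 p q) [1, 2, 3] F j = foldr (chamber_op 3 p q) [3, 2, 1] F j"
proof -
  define a1 b1 a2 b2 where "a1 = A 1" and "b1 = A 3" and "a2 = B 1" and "b2 = B 3"
  note AB = A B a1_def[symmetric] b1_def[symmetric] a2_def[symmetric] b2_def[symmetric]
  define c where "c = \<kappa> 1"
  \<comment> \<open>The denominators stay opaque until they have been cleared.\<close>
  define e1 e2 e3 where e: "e1 = a1 - a2" "e2 = a1 * b1 - a2 * b2" "e3 = b1 - b2"
  have nz: "e1 \<noteq> 0" "e2 \<noteq> 0" "e3 \<noteq> 0"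
    using neq[of 1] neq[of 2] neq[of 3] by (simp_all add: e AB del: One_nat_def)
  have pq: "p (Suc 0) = c * a1 / e1" "p 2 = c * (a1 * b1) / e2" "p 3 = c * b1 / e3"
    "q (Suc 0) = c * a2 / e1" "q 2 = c * (a2 * b2) / e2" "q 3 = c * b2 / e3"
    using p[of 1] p[of 2] p[of 3] q[of 1] q[of 2] q[of 3] by (simp_all add: e AB \<kappa> flip: One_nat_def c_def)
  have *: "\<forall>j\<in>{0, 1, 2, 3, 4, 5}. \<forall>k\<in>{0, 1, 2, 3, 4, 5}.
      foldr (chamber_op 3 p q) [1, 2, 3] (\<lambda>l. of_bool (l = k)) j =
      foldr (chamber_op 3 p q) [3, 2, 1] (\<lambda>l. of_bool (l = k)) j"
    by (intro ballI; elim insertE emptyE; hypsubst; simp add: chamber_op_def;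
        (simp add: pq nz divide_simps; unfold e; Groebner_Basis.algebra)?)
  have "j \<in> {0, 1, 2, 3, 4, 5}" if "j < 2 * 3" for j :: nat
    using that by (simp, arith)
  with * show ?thesis using \<open>j < 6\<close> by - (rule chamber_op_eqI, blast, simp)
qed

lemma chamber_op_B2:
  fixes A B p q \<kappa> :: "nat \<Rightarrow> 'k::field"
  assumes p: "\<And>i. i \<in> {1..4} \<Longrightarrow> p i = \<kappa> i * A i / (A i - B i)"
    and q: "\<And>i. i \<in> {1..4} \<Longrightarrow> q i = \<kappa> i * B i / (A i - B i)"
    and neq: "\<And>i. i \<in> {1..4} \<Longrightarrow> A i \<noteq> B i"
    and \<kappa>: "\<kappa> 3 = \<kappa> 1" "\<kappa> 4 = \<kappa> 2"
    and A: "A 2 = A 1 * A 3" "A 3 = A 1 * A 4"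
    and B: "B 2 = B 1 * B 3" "B 3 = B 1 * B 4"
    and "j < 8"
  shows "foldr (chamber_op 4 p q) [1, 2, 3, 4] F j = foldr (chamber_op 4 p q) [4, 3, 2, 1] F j"
proof -
  define a1 b1 a2 b2 where "a1 = A 1" and "b1 = A 4" and "a2 = B 1" and "b2 = B 4"
  note AB = A B a1_def[symmetric] b1_def[symmetric] a2_def[symmetric] b2_def[symmetric]
  define c d where "c = \<kappa> 1" and "d = \<kappa> 2"
  note cd = \<kappa> c_def[symmetric] d_def[symmetric]
  define e1 e2 e3 e4
    where e: "e1 = a1 - a2" "e2 = a1 * (a1 * b1) - a2 * (a2 * b2)"
      "e3 = a1 * b1 - a2 * b2" "e4 = b1 - b2"
  have nz: "e1 \<noteq> 0" "e2 \<noteq> 0" "e3 \<noteq> 0" "e4 \<noteq> 0"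
    using neq[of 1] neq[of 2] neq[of 3] neq[of 4] by (simp_all add: e AB del: One_nat_def)
  have p': "p (Suc 0) = c * a1 / e1" "p 2 = d * (a1 * (a1 * b1)) / e2"
    "p 3 = c * (a1 * b1) / e3" "p 4 = d * b1 / e4"
    using p[of 1] p[of 2] p[of 3] p[of 4] by (simp_all add: e AB cd flip: One_nat_def)
  have q': "q (Suc 0) = c * a2 / e1" "q 2 = d * (a2 * (a2 * b2)) / e2"
    "q 3 = c * (a2 * b2) / e3" "q 4 = d * b2 / e4"
    using q[of 1] q[of 2] q[of 3] q[of 4] by (simp_all add: e AB cd flip: One_nat_def)
  have *: "\<forall>j\<in>{0, 1, 2, 3, 4, 5, 6, 7}. \<forall>k\<in>{0, 1, 2, 3, 4, 5, 6, 7}.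
      foldr (chamber_op 4 p q) [1, 2, 3, 4] (\<lambda>l. of_bool (l = k)) j =
      foldr (chamber_op 4 p q) [4, 3, 2, 1] (\<lambda>l. of_bool (l = k)) j"
    by (intro ballI; elim insertE emptyE; hypsubst; simp add: chamber_op_def;
        (simp add: p' q' nz divide_simps; unfold e; Groebner_Basis.algebra)?)
  have "j \<in> {0, 1, 2, 3, 4, 5, 6, 7}" if "j < 2 * 4" for j :: nat
    using that by (simp, arith)
  with * show ?thesis using \<open>j < 8\<close> by - (rule chamber_op_eqI, blast, simp)
qed

lemma chamber_op_G2:
  fixes A B p q \<kappa> :: "nat \<Rightarrow> 'k::field"
  assumes p: "\<And>i. i \<in> {1..6} \<Longrightarrow> p i = \<kappa> i * A i / (A i - B i)"
    and q: "\<And>i. i \<in> {1..6} \<Longrightarrow> q i = \<kappa> i * B i / (A i - B i)"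
    and neq: "\<And>i. i \<in> {1..6} \<Longrightarrow> A i \<noteq> B i"
    and \<kappa>: "\<kappa> 3 = \<kappa> 1" "\<kappa> 5 = \<kappa> 3" "\<kappa> 4 = \<kappa> 2" "\<kappa> 6 = \<kappa> 4"
    and A: "A 2 = A 1 * A 3" "A 3 = A 1 * A 5" "A 4 = A 3 * A 5" "A 5 = A 1 * A 6"
    and B: "B 2 = B 1 * B 3" "B 3 = B 1 * B 5" "B 4 = B 3 * B 5" "B 5 = B 1 * B 6"
    and "j < 12"
  shows "foldr (chamber_op 6 p q) [1, 2, 3, 4, 5, 6] F j =
    foldr (chamber_op 6 p q) [6, 5, 4, 3, 2, 1] F j"
proof -
  define a1 b1 a2 b2 where "a1 = A 1" and "b1 = A 6" and "a2 = B 1" and "b2 = B 6"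
  note AB = A B a1_def[symmetric] b1_def[symmetric] a2_def[symmetric] b2_def[symmetric]
  define c d where "c = \<kappa> 1" and "d = \<kappa> 2"
  note cd = \<kappa> c_def[symmetric] d_def[symmetric]
  define e1 e2 e3 e4 e5 e6
    where e: "e1 = a1 - a2" "e2 = a1 * (a1 * (a1 * b1)) - a2 * (a2 * (a2 * b2))"
      "e3 = a1 * (a1 * b1) - a2 * (a2 * b2)"
      "e4 = a1 * (a1 * b1) * (a1 * b1) - a2 * (a2 * b2) * (a2 * b2)"
      "e5 = a1 * b1 - a2 * b2" "e6 = b1 - b2"
  have nz: "e1 \<noteq> 0" "e2 \<noteq> 0" "e3 \<noteq> 0" "e4 \<noteq> 0" "e5 \<noteq> 0" "e6 \<noteq> 0"
    using neq[of 1] neq[of 2] neq[of 3] neq[of 4] neq[of 5] neq[of 6] by (simp_all add: e AB del: One_nat_def)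
  have p': "p (Suc 0) = c * a1 / e1" "p 2 = d * (a1 * (a1 * (a1 * b1))) / e2"
    "p 3 = c * (a1 * (a1 * b1)) / e3" "p 4 = d * (a1 * (a1 * b1) * (a1 * b1)) / e4"
    "p 5 = c * (a1 * b1) / e5" "p 6 = d * b1 / e6"
    using p[of 1] p[of 2] p[of 3] p[of 4] p[of 5] p[of 6] by (simp_all add: e AB cd flip: One_nat_def)
  have q': "q (Suc 0) = c * a2 / e1" "q 2 = d * (a2 * (a2 * (a2 * b2))) / e2"
    "q 3 = c * (a2 * (a2 * b2)) / e3" "q 4 = d * (a2 * (a2 * b2) * (a2 * b2)) / e4"
    "q 5 = c * (a2 * b2) / e5" "q 6 = d * b2 / e6"
    using q[of 1] q[of 2] q[of 3] q[of 4] q[of 5] q[of 6] by (simp_all add: e AB cd flip: One_nat_def)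
  have *: "\<forall>j\<in>{0, 1, 2, 3, 4, 5, 6, 7, 8, 9, 10, 11}. \<forall>k\<in>{0, 1, 2, 3, 4, 5, 6, 7, 8, 9, 10, 11}.
      foldr (chamber_op 6 p q) [1, 2, 3, 4, 5, 6] (\<lambda>l. of_bool (l = k)) j =
      foldr (chamber_op 6 p q) [6, 5, 4, 3, 2, 1] (\<lambda>l. of_bool (l = k)) j"
    by (intro ballI; elim insertE emptyE; hypsubst; simp add: chamber_op_def;
        (simp add: p' q' nz divide_simps; unfold e; Groebner_Basis.algebra)?)
  have "j \<in> {0, 1, 2, 3, 4, 5, 6, 7, 8, 9, 10, 11}" if "j < 2 * 6" for j :: nat
    using that by (simp, arith)
  with * show ?thesis using \<open>j < 12\<close> by - (rule chamber_op_eqI, blast, simp)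
qed

section \<open>Operators on the group algebra\<close>

lemma free_module_iff: "f \<in> free_module X \<longleftrightarrow> (\<forall>x. x \<notin> X \<longrightarrow> Poly_Mapping.lookup f x = 0)"
  by (auto simp: free_module_def in_keys_iff)

lemma lookup_fm_scale: "Poly_Mapping.lookup (fm_scale c f) x = c * Poly_Mapping.lookup f x"
  by (simp add: fm_scale_def Poly_Mapping.map.rep_eq when_def)

lemma free_module_add: "f \<in> free_module X \<Longrightarrow> g \<in> free_module X \<Longrightarrow> f + g \<in> free_module X"
  by (simp add: free_module_iff lookup_add)

lemma free_module_scale: "f \<in> free_module X \<Longrightarrow> fm_scale c f \<in> free_module X"
  by (simp add: free_module_iff lookup_fm_scale)

lemma mprod_End_monoid:
  "mprod (End_monoid X) Fs = restrict (foldr (\<lambda>F. F) Fs) (free_module X)"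
proof (induction Fs)
  case Nil
  then show ?case by (simp add: mprod_def End_monoid_def fun_eq_iff restrict_def)
next
  case (Cons F Fs)
  have "mprod (End_monoid X) (F # Fs) = compose (free_module X) F (mprod (End_monoid X) Fs)"
    by (simp add: mprod_def End_monoid_def)
  then show ?case by (simp add: Cons fun_eq_iff compose_def restrict_def)
qed

lemma foldr_id_map: "foldr (\<lambda>F. F) (map h xs) = foldr h xs"
  by (induction xs) simp_all

context positive_roots
begin

lemma inner_root_reflection_self:
  assumes "\<alpha> \<in> P"
  shows "root_reflection \<alpha> y \<bullet> \<alpha> = - (y \<bullet> \<alpha>)"
proof -
  have "\<alpha> \<noteq> 0" using assms P_\<Phi> root_system_nonzero[OF \<Phi>] by blast
  then show ?thesis
    using inner_root_reflection[of \<alpha> y \<alpha>] unfolding root_reflection_self[OF \<open>\<alpha> \<noteq> 0\<close>] by simp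
qed

text \<open>The matrix of \<open>M\<^sub>\<tau>\<close> read by rows: the coefficient of \<open>w\<close> in the image comes from \<open>\<tau> w\<close> alone. The
  weight is \<open>q\<close> when \<open>w\<close> is on the positive side, since \<open>w\<close> is then the shorter of \<open>w\<close> and \<open>\<tau> w\<close>.\<close>

lemma lookup_mixed_op:
  assumes f: "f \<in> free_module (weyl_group \<Phi>)" and \<alpha>: "\<alpha> \<in> P"
  shows "Poly_Mapping.lookup (mixed_op P p q (root_reflection \<alpha>) f) w =
    (if w \<in> weyl_group \<Phi>
     then (if 0 < w \<gamma> \<bullet> \<alpha> then q (root_reflection \<alpha>) else p (root_reflection \<alpha>)) *
       Poly_Mapping.lookup f (root_reflection \<alpha> \<circ> w)
     else 0)"
proof -
  let ?s = "root_reflection \<alpha>"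
  define c where "c x = (if weyl_length P x < weyl_length P (?s \<circ> x) then p ?s else q ?s)" for x
  have keys: "x \<in> weyl_group \<Phi>" if "x \<in> Poly_Mapping.keys f" for x
    using f that by (auto simp: free_module_def)
  have sW: "?s \<in> weyl_group \<Phi>" using \<alpha> P_\<Phi> weyl_group_reflection by blast
  have ss: "?s \<circ> (?s \<circ> x) = x" for x by (simp add: fun_eq_iff)
  have "Poly_Mapping.lookup (mixed_op P p q ?s f) w =
      (\<Sum>x\<in>Poly_Mapping.keys f. Poly_Mapping.lookup f x *
        Poly_Mapping.lookup (Poly_Mapping.single (?s \<circ> x) (c x)) w)"
    unfolding mixed_op_def fm_extend_def lookup_sum lookup_fm_scale c_def
    by (intro sum.cong) (simp_all add: GV_mult weyl_group_bij[OF keys])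
  also have "\<dots> = (\<Sum>x\<in>Poly_Mapping.keys f. if x = ?s \<circ> w then Poly_Mapping.lookup f (?s \<circ> w) * c (?s \<circ> w) else 0)"
  proof (intro sum.cong refl)
    fix x
    have "?s \<circ> x = w \<longleftrightarrow> x = ?s \<circ> w" using ss by metis
    then show "Poly_Mapping.lookup f x * Poly_Mapping.lookup (Poly_Mapping.single (?s \<circ> x) (c x)) w =
        (if x = ?s \<circ> w then Poly_Mapping.lookup f (?s \<circ> w) * c (?s \<circ> w) else 0)"
      by (auto simp: lookup_single when_def simp del: comp_apply)
  qed
  also have "\<dots> = Poly_Mapping.lookup f (?s \<circ> w) * c (?s \<circ> w)"
    by (simp add: sum.delta in_keys_iff)
  finally have eq: "Poly_Mapping.lookup (mixed_op P p q ?s f) w = Poly_Mapping.lookup f (?s \<circ> w) * c (?s \<circ> w)" .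
  show ?thesis
  proof (cases "w \<in> weyl_group \<Phi>")
    case True
    then have "?s \<circ> w \<in> weyl_group \<Phi>" using weyl_group_comp sW by blast
    then have "weyl_length P (?s \<circ> w) < weyl_length P w \<longleftrightarrow> 0 < (?s \<circ> w) \<gamma> \<bullet> \<alpha>"
      using weyl_length_reflection_iff[OF _ \<alpha>] ss by metis
    also have "\<dots> \<longleftrightarrow> \<not> 0 < w \<gamma> \<bullet> \<alpha>"
      using inner_root_reflection_self[OF \<alpha>, of "w \<gamma>"] inner_weyl_nonzero[OF True P_\<Phi>[OF \<alpha>]] by (simp, linarith)
    finally show ?thesis unfolding eq c_def ss using True by (simp add: mult.commute)
  next
    case False
    then have "?s \<circ> w \<notin> weyl_group \<Phi>" using weyl_group_comp[OF sW, of "?s \<circ> w"] ss by metis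
    then show ?thesis unfolding eq using f False by (simp add: free_module_iff del: comp_apply)
  qed
qed

lemma lookup_mixed_R:
  fixes p q :: "('v \<Rightarrow> 'v) \<Rightarrow> 'k::field"
  assumes f: "f \<in> free_module (weyl_group \<Phi>)" and \<alpha>: "\<alpha> \<in> P"
  shows "Poly_Mapping.lookup (mixed_R \<Phi> P p q (root_reflection \<alpha>) f) w =
    (if w \<in> weyl_group \<Phi>
     then Poly_Mapping.lookup f w +
       [:0, if 0 < w \<gamma> \<bullet> \<alpha> then q (root_reflection \<alpha>) else p (root_reflection \<alpha>):] *
       Poly_Mapping.lookup f (root_reflection \<alpha> \<circ> w)
     else 0)"
proof -
  have "[:0, 1:] * ([:c:] * g) = [:0, c:] * g" for c :: 'k and g
    by (simp flip: mult.assoc)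
  then show ?thesis
    using f by (simp add: mixed_R_def lookup_add lookup_fm_scale lookup_mixed_op[OF f \<alpha>] free_module_iff del: comp_apply)
qed

lemma mixed_R_free_module:
  assumes "f \<in> free_module (weyl_group \<Phi>)" "\<alpha> \<in> P"
  shows "mixed_R \<Phi> P p q (root_reflection \<alpha>) f \<in> free_module (weyl_group \<Phi>)"
  by (simp add: free_module_iff lookup_mixed_R[OF assms] del: comp_apply)

lemma mixed_R_carrier:
  assumes "\<alpha> \<in> P"
  shows "mixed_R \<Phi> P p q (root_reflection \<alpha>) \<in> carrier (End_monoid (weyl_group \<Phi>))"
proof -
  let ?M = "free_module (weyl_group \<Phi>)" and ?R = "mixed_R \<Phi> P p q (root_reflection \<alpha>)"
  note lookup = lookup_mixed_R[OF _ assms]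
  have "?R (f + g) = ?R f + ?R g" if "f \<in> ?M" "g \<in> ?M" for f g
    using that by (intro poly_mapping_eqI)
      (simp add: lookup free_module_add lookup_add algebra_simps smult_add_right del: comp_apply)
  moreover have "?R (fm_scale c f) = fm_scale c (?R f)" if "f \<in> ?M" for c f
    using that by (intro poly_mapping_eqI)
      (simp add: lookup free_module_scale lookup_fm_scale algebra_simps del: comp_apply)
  moreover have "?R \<in> ?M \<rightarrow>\<^sub>E ?M"
  proof -
    have "?R f = undefined" if "f \<notin> ?M" for f using that by (simp add: mixed_R_def)
    then show ?thesis using mixed_R_free_module[OF _ assms] by (auto simp: PiE_iff extensional_def)
  qed
  ultimately show ?thesis by (simp add: End_monoid_def)
qed

text \<open>Restricted to a gallery and with \<open>\<epsilon>\<close> specialized to \<open>t\<close>, the operators \<open>R\<^sub>\<tau>\<close> become the chamber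
  operators. The variable \<open>t\<close> is absorbed by the weights.\<close>

lemma foldr_mixed_R:
  fixes p q :: "('v \<Rightarrow> 'v) \<Rightarrow> 'k::field"
  assumes f: "f \<in> free_module (weyl_group \<Phi>)" and G: "gallery m \<rho> G" and m: "m > 0"
    and \<rho>: "\<And>i. i \<in> {1..m} \<Longrightarrow> \<rho> i \<in> P" and "set is \<subseteq> {1..m}"
  shows "foldr (\<lambda>i. mixed_R \<Phi> P p q (root_reflection (\<rho> i))) is f \<in> free_module (weyl_group \<Phi>) \<and>
    (\<forall>j<2 * m. poly (Poly_Mapping.lookup (foldr (\<lambda>i. mixed_R \<Phi> P p q (root_reflection (\<rho> i))) is f) (G j)) t =
      foldr (chamber_op m (\<lambda>i. t * p (root_reflection (\<rho> i))) (\<lambda>i. t * q (root_reflection (\<rho> i)))) is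
        (\<lambda>j. poly (Poly_Mapping.lookup f (G j)) t) j)"
  using assms(5)
proof (induction "is")
  case Nil
  then show ?case using f by simp
next
  case (Cons i "is")
  let ?g = "foldr (\<lambda>i. mixed_R \<Phi> P p q (root_reflection (\<rho> i))) is f"
  have i: "i \<in> {1..m}" and g: "?g \<in> free_module (weyl_group \<Phi>)" using Cons by auto
  have IH: "poly (Poly_Mapping.lookup ?g (G j)) t =
      foldr (chamber_op m (\<lambda>i. t * p (root_reflection (\<rho> i))) (\<lambda>i. t * q (root_reflection (\<rho> i)))) is
        (\<lambda>j. poly (Poly_Mapping.lookup f (G j)) t) j" if "j < 2 * m" for j
    using Cons that by simp
  have "poly (Poly_Mapping.lookup (mixed_R \<Phi> P p q (root_reflection (\<rho> i)) ?g) (G j)) t =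
      poly (Poly_Mapping.lookup ?g (G j)) t +
      (if j < i \<or> i + m \<le> j then t * q (root_reflection (\<rho> i)) else t * p (root_reflection (\<rho> i))) *
      poly (Poly_Mapping.lookup ?g (G ((2 * i + (2 * m - 1) - j) mod (2 * m)))) t" if "j < 2 * m" for j
  proof -
    have "G j \<in> weyl_group \<Phi>" "root_reflection (\<rho> i) \<circ> G j = G ((2 * i + (2 * m - 1) - j) mod (2 * m))"
      "0 < G j \<gamma> \<bullet> \<rho> i \<longleftrightarrow> j < i \<or> i + m \<le> j"
      using G i that by (auto simp: gallery_def simp del: comp_apply)
    then show ?thesis by (simp add: lookup_mixed_R[OF g \<rho>[OF i]] del: comp_apply)
  qed
  moreover have "(2 * i + (2 * m - 1) - j) mod (2 * m) < 2 * m" for j using m by simp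
  ultimately show ?case
    using mixed_R_free_module[OF g \<rho>[OF i]] by (simp add: chamber_op_def[of m _ _ i] IH)
qed

text \<open>Every basis element lies on some gallery, and a polynomial over an infinite field is determined by
  its values. So the equation in \<open>k[\<epsilon>] \<otimes> k[W]\<close> follows from its specializations on \<open>2 m\<close> chambers.\<close>

lemma yang_baxter_rank_two:
  fixes p q :: "('v \<Rightarrow> 'v) \<Rightarrow> 'k::field_char_0"
  assumes roots: "rank_two_roots \<alpha> \<beta> m \<rho>" "\<beta> \<in> P" "\<And>i. i \<in> {1..m} \<Longrightarrow> \<rho> i \<in> P"
    and chamber: "\<And>t F j. j < 2 * m \<Longrightarrow>
      foldr (chamber_op m (\<lambda>i. t * p (root_reflection (\<rho> i))) (\<lambda>i. t * q (root_reflection (\<rho> i)))) [1..<Suc m] F j =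
      foldr (chamber_op m (\<lambda>i. t * p (root_reflection (\<rho> i))) (\<lambda>i. t * q (root_reflection (\<rho> i)))) (rev [1..<Suc m]) F j"
  defines "ts \<equiv> dihedral_reflections (root_reflection \<alpha>) (root_reflection \<beta>)"
  shows "mprod (End_monoid (weyl_group \<Phi>)) (map (mixed_R \<Phi> P p q) ts) =
    mprod (End_monoid (weyl_group \<Phi>)) (map (mixed_R \<Phi> P p q) (rev ts))"
proof -
  let ?a = "root_reflection \<alpha>" and ?b = "root_reflection \<beta>"
  have pair: "dihedral_pair ?a ?b m" and ord: "group.ord GV (?a \<circ> ?b) = m" and "\<rho> 1 = \<alpha>"
    using roots(1) by (auto simp: rank_two_roots_def)
  have m: "m > 0" using pair by (simp add: dihedral_pair_def)
  then have \<alpha>: "\<alpha> \<in> P" using roots(3)[of 1] \<open>\<rho> 1 = \<alpha>\<close> by simp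
  have "ts = map (\<lambda>i. root_reflection (\<rho> (Suc i))) [0..<m]"
    unfolding ts_def dihedral_reflections_eq[OF bij_root_reflection bij_root_reflection ord]
    using rank_two_roots_reflection[OF roots(1)] by (intro map_cong) auto
  also have "\<dots> = map (\<lambda>i. root_reflection (\<rho> i)) [1..<Suc m]"
    by (simp only: map_Suc_upt[symmetric] map_map One_nat_def) (simp add: comp_def)
  finally have ts: "ts = map (\<lambda>i. root_reflection (\<rho> i)) [1..<Suc m]" .
  define R where "R i = mixed_R \<Phi> P p q (root_reflection (\<rho> i))" for i
  have "foldr R [1..<Suc m] f = foldr R (rev [1..<Suc m]) f" if f: "f \<in> free_module (weyl_group \<Phi>)" for f
  proof (rule poly_mapping_eqI)
    fix w
    show "Poly_Mapping.lookup (foldr R [1..<Suc m] f) w = Poly_Mapping.lookup (foldr R (rev [1..<Suc m]) f) w"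
    proof (cases "w \<in> weyl_group \<Phi>")
      case True
      have "((?a \<circ> ?b) ^^ (i - 1)) \<circ> ?a = root_reflection (\<rho> i)" if "i \<in> {1..m}" for i
        using rank_two_roots_reflection[OF roots(1), of "i - 1"] that by (cases i) auto
      moreover have "0 < alternating ?a ?b j y \<bullet> \<rho> i \<longleftrightarrow> j < i \<or> i + m \<le> j"
        if "0 < y \<bullet> \<alpha>" "0 < y \<bullet> \<beta>" "i \<in> {1..m}" "j < 2 * m" for y i j
        using roots(1) that by (simp add: rank_two_roots_def)
      ultimately obtain G j where G: "gallery m \<rho> G" and j: "j < 2 * m" "w = G j"
        using gallery_exists[OF \<alpha> roots(2) pair _ _ True] by metis
      have "poly (Poly_Mapping.lookup (foldr R [1..<Suc m] f) w) t =
          poly (Poly_Mapping.lookup (foldr R (rev [1..<Suc m]) f) w) t" for t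
        using foldr_mixed_R[OF f G m roots(3), of "[1..<Suc m]" p q t]
          foldr_mixed_R[OF f G m roots(3), of "rev [1..<Suc m]" p q t] chamber[OF j(1)] j
        unfolding R_def by (simp del: upt_Suc add: atLeastLessThanSuc_atLeastAtMost)
      then show ?thesis by (simp add: fun_eq_iff flip: poly_eq_poly_eq_iff)
    next
      case False
      have "foldr R is f \<in> free_module (weyl_group \<Phi>)" if "set is \<subseteq> {1..m}" for "is"
        using that by (induction "is") (use f roots(3) in \<open>auto intro!: mixed_R_free_module simp: R_def\<close>)
      then show ?thesis
        using False by (simp add: free_module_iff atLeastLessThanSuc_atLeastAtMost del: upt_Suc)
    qed
  qed
  then have "restrict (foldr R [1..<Suc m]) (free_module (weyl_group \<Phi>)) =
      restrict (foldr R (rev [1..<Suc m])) (free_module (weyl_group \<Phi>))"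
    by (rule restrict_ext)
  then show ?thesis
    unfolding ts mprod_End_monoid
    by (simp only: R_def[abs_def] foldr_id_map rev_map map_map comp_def)
qed

end

section \<open>The Yang-Baxter equations\<close>

lemma rank_two_roots_mem:
  assumes "rank_two_roots \<alpha> \<beta> m \<rho>" "root_system \<Phi>" "\<alpha> \<in> \<Phi>" "\<beta> \<in> \<Phi>" "i \<in> {1..m}"
  shows "\<rho> i \<in> \<Phi>"
  using assms(5)
proof (induction i rule: less_induct)
  case (less i)
  consider "i = 1" | "i = 2" | k where "i = k + 2" "k \<ge> 1"
    using less.prems by (metis One_nat_def add_2_eq_Suc' atLeastAtMost_iff less_one not_less not0_implies_Suc numeral_2_eq_2)
  then show ?case
  proof cases
    case 3
    then have "\<rho> k \<in> \<Phi>" "\<rho> i = root_reflection \<alpha> (root_reflection \<beta> (\<rho> k))"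
      using less assms(1) by (auto simp: rank_two_roots_def)
    then show ?thesis using assms root_system_reflection by metis
  qed (use assms root_system_reflection in \<open>auto simp: rank_two_roots_def\<close>)
qed

lemma rank_two_roots_norm:
  assumes "rank_two_roots \<alpha> \<beta> m \<rho>" "i \<ge> 1" "i + 2 \<le> m"
  shows "norm (\<rho> (i + 2)) = norm (\<rho> i)"
  using assms by (simp add: rank_two_roots_def norm_eq_sqrt_inner inner_root_reflection)

lemma rank_two_roots_swap:
  assumes "rank_two_roots \<alpha> \<beta> m \<rho>"
  shows "dihedral_reflections (root_reflection \<beta>) (root_reflection \<alpha>) =
    rev (dihedral_reflections (root_reflection \<alpha>) (root_reflection \<beta>))"
  using assms by (intro dihedral_reflections_swap[of _ _ m]) (auto simp: rank_two_roots_def)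

lemma upt_1_to:
  "[1..<Suc 2] = [1, 2]" "[1..<Suc 3] = [1, 2, 3]" "[1..<Suc 4] = [1, 2, 3, 4]"
  "[1..<Suc 6] = [1, 2, 3, 4, 5, 6]"
  by (simp_all add: upt_rec)

lemma scaleR_combination_add:
  "(c *\<^sub>R x + d *\<^sub>R y) + (c' *\<^sub>R x + d' *\<^sub>R y) = (c + c') *\<^sub>R x + (d + d') *\<^sub>R (y :: 'a::real_vector)"
  by (simp add: algebra_simps)

text \<open>The root subsystem of a reflection subgroup inherits the theory above, because the reflections in
  a subgroup are closed under conjugation. Its simple roots are in general not simple in \<open>\<Phi>\<close>.\<close>

lemma (in positive_roots) root_subsystem_positive_roots:
  assumes "subgroup W' GV"
  shows "positive_roots (root_subsystem \<Phi> W') (root_subsystem \<Phi> W' \<inter> P) \<gamma>"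
proof
  let ?\<Phi>' = "root_subsystem \<Phi> W'"
  have sub: "?\<Phi>' \<subseteq> \<Phi>" by (auto simp: root_subsystem_def)
  have "root_reflection \<alpha> \<beta> \<in> ?\<Phi>'" if "\<alpha> \<in> ?\<Phi>'" "\<beta> \<in> ?\<Phi>'" for \<alpha> \<beta>
  proof -
    let ?a = "root_reflection \<alpha>" and ?b = "root_reflection \<beta>"
    have "?a \<otimes>\<^bsub>GV\<^esub> ?b \<otimes>\<^bsub>GV\<^esub> ?a \<in> W'"
      using that assms by (simp add: root_subsystem_def subgroup.m_closed)
    moreover have "?a \<otimes>\<^bsub>GV\<^esub> ?b \<otimes>\<^bsub>GV\<^esub> ?a = ?a \<circ> ?b \<circ> ?a"
      by (simp only: GV_mult bij_root_reflection bij_comp)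
    moreover have "?a \<circ> ?b \<circ> ?a = root_reflection (?a \<beta>)"
      using root_reflection_conjugate[OF orthogonal_root_reflection, of \<alpha> \<beta> "?a x" for x] by (simp add: fun_eq_iff)
    ultimately show ?thesis
      using that root_system_reflection[OF \<Phi>] by (auto simp: root_subsystem_def)
  qed
  then show "root_system ?\<Phi>'"
    using \<Phi> sub finite_subset[OF sub] unfolding root_system_def by (intro conjI) blast+
  show "\<gamma> \<bullet> \<alpha> \<noteq> 0" if "\<alpha> \<in> ?\<Phi>'" for \<alpha> using that sub regular by auto
  show "?\<Phi>' \<inter> P = {\<alpha> \<in> ?\<Phi>'. 0 < \<gamma> \<bullet> \<alpha>}" using sub by (auto simp: P_def)
qed

text \<open>The data of the theorem, with reflections replaced by their positive roots.\<close>

locale mixed_weights = positive_roots \<Phi> P \<gamma>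
  for \<Phi> P :: "'v::euclidean_space set" and \<gamma> +
  fixes E1 E2 :: "'v \<Rightarrow> 'k::field_char_0" and \<kappa> p q :: "('v \<Rightarrow> 'v) \<Rightarrow> 'k"
  assumes E1: "multiplicative_on P E1" and E2: "multiplicative_on P E2"
    and E_neq: "\<alpha> \<in> P \<Longrightarrow> E1 \<alpha> \<noteq> E2 \<alpha>"
    and \<kappa>: "\<alpha> \<in> P \<Longrightarrow> \<beta> \<in> P \<Longrightarrow> norm \<alpha> = norm \<beta> \<Longrightarrow> \<kappa> (root_reflection \<alpha>) = \<kappa> (root_reflection \<beta>)"
    and p: "\<alpha> \<in> P \<Longrightarrow> p (root_reflection \<alpha>) = \<kappa> (root_reflection \<alpha>) * E1 \<alpha> / (E1 \<alpha> - E2 \<alpha>)"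
    and q: "\<alpha> \<in> P \<Longrightarrow> q (root_reflection \<alpha>) = \<kappa> (root_reflection \<alpha>) * E2 \<alpha> / (E1 \<alpha> - E2 \<alpha>)"
begin

definition satisfies_yang_baxter :: "('v \<Rightarrow> 'v) \<Rightarrow> ('v \<Rightarrow> 'v) \<Rightarrow> bool" where
  "satisfies_yang_baxter a b \<longleftrightarrow>
     mprod (End_monoid (weyl_group \<Phi>)) (map (mixed_R \<Phi> P p q) (dihedral_reflections a b)) =
     mprod (End_monoid (weyl_group \<Phi>)) (map (mixed_R \<Phi> P p q) (rev (dihedral_reflections a b)))"

text \<open>Nonnegative combinations of positive roots are positive as soon as they are roots.\<close>

lemma rank_two_root_P:
  assumes "rank_two_roots \<alpha> \<beta> m \<rho>" "\<alpha> \<in> P" "\<beta> \<in> P" "i \<in> {1..m}"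
    and "\<rho> i = c *\<^sub>R \<alpha> + d *\<^sub>R \<beta>" "c \<ge> 0" "d \<ge> 0"
  shows "\<rho> i \<in> P"
proof -
  have "\<rho> i \<in> \<Phi>" using rank_two_roots_mem[OF assms(1) \<Phi>] assms P_\<Phi> by blast
  moreover have "\<gamma> \<bullet> \<rho> i \<ge> 0"
    using assms(5-7) P_pos[OF assms(2)] P_pos[OF assms(3)] by (simp add: inner_add_right)
  ultimately show ?thesis using regular[of "\<rho> i"] by (simp add: P_def)
qed

lemma rank_two_yang_baxter:
  assumes "rank_two_roots \<alpha> \<beta> m \<rho>" "\<beta> \<in> P" "\<And>i. i \<in> {1..m} \<Longrightarrow> \<rho> i \<in> P"
    and "\<And>t F j. j < 2 * m \<Longrightarrow>
      foldr (chamber_op m (\<lambda>i. t * p (root_reflection (\<rho> i))) (\<lambda>i. t * q (root_reflection (\<rho> i)))) [1..<Suc m] F j =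
      foldr (chamber_op m (\<lambda>i. t * p (root_reflection (\<rho> i))) (\<lambda>i. t * q (root_reflection (\<rho> i)))) (rev [1..<Suc m]) F j"
  shows "satisfies_yang_baxter (root_reflection \<alpha>) (root_reflection \<beta>) \<and>
    satisfies_yang_baxter (root_reflection \<beta>) (root_reflection \<alpha>)"
  using yang_baxter_rank_two[OF assms]
  by (simp add: satisfies_yang_baxter_def rank_two_roots_swap[OF assms(1)])

text \<open>The scalars \<open>\<kappa>\<close> have period two along \<open>\<rho> 1, \<dots>, \<rho> m\<close>, since \<open>\<rho> (i + 2)\<close> is the image of \<open>\<rho> i\<close> under a
  rotation.\<close>

lemma \<kappa>_shift:
  assumes "rank_two_roots \<alpha> \<beta> m \<rho>" "\<And>i. i \<in> {1..m} \<Longrightarrow> \<rho> i \<in> P" "k = i + 2" "i \<ge> 1" "k \<le> m"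
  shows "\<kappa> (root_reflection (\<rho> k)) = \<kappa> (root_reflection (\<rho> i))"
  using \<kappa>[OF assms(2) assms(2)] rank_two_roots_norm[OF assms(1,4)] assms(3-5) by simp

lemma E_sum:
  assumes "\<alpha> = \<beta> + \<delta>" "\<alpha> \<in> P" "\<beta> \<in> P" "\<delta> \<in> P"
  shows "E1 \<alpha> = E1 \<beta> * E1 \<delta>" "E2 \<alpha> = E2 \<beta> * E2 \<delta>"
  using E1 E2 assms unfolding multiplicative_on_def by blast+

lemma yang_baxter_A1A1:
  assumes pair: "rank_two_pair \<alpha> \<beta> 0 0" and roots: "\<alpha> \<in> P" "\<beta> \<in> P"
  shows "satisfies_yang_baxter (root_reflection \<alpha>) (root_reflection \<beta>) \<and>
    satisfies_yang_baxter (root_reflection \<beta>) (root_reflection \<alpha>)"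
proof -
  define \<rho> where "\<rho> i = ([1, 0] ! (i - 1)) *\<^sub>R \<alpha> + ([0, 1] ! (i - 1)) *\<^sub>R \<beta>" for i
  have roots2: "rank_two_roots \<alpha> \<beta> 2 \<rho>"
    using rank_two_A1A1[OF pair] by (simp add: \<rho>_def[abs_def])
  have mem: "\<rho> i \<in> P" if "i \<in> {1..2}" for i
  proof -
    have "i \<in> {1, 2}" using that by (simp, arith)
    then have "[1, 0] ! (i - 1) \<ge> (0 :: real)" "[0, 1] ! (i - 1) \<ge> (0 :: real)" by auto
    then show ?thesis by (rule rank_two_root_P[OF roots2 roots that \<rho>_def])
  qed
  show ?thesis
  proof (rule rank_two_yang_baxter[OF roots2 roots(2) mem])
    fix t F j
    assume j: "j < 2 * (2 :: nat)"
    show "foldr (chamber_op 2 (\<lambda>i. t * p (root_reflection (\<rho> i))) (\<lambda>i. t * q (root_reflection (\<rho> i)))) [1..<Suc 2] F j =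
      foldr (chamber_op 2 (\<lambda>i. t * p (root_reflection (\<rho> i))) (\<lambda>i. t * q (root_reflection (\<rho> i)))) (rev [1..<Suc 2]) F j"
      unfolding upt_1_to rev.simps append.simps
      by (rule chamber_op_A1A1) (use j in simp)
  qed
qed

text \<open>In the following types, the sums among the \<open>\<rho> i\<close> are sums of roots of \<open>\<Phi>\<close>, so multiplicativity on \<open>P\<close> applies to them even if
  the subsystem is not closed under addition in \<open>\<Phi>\<close>.\<close>

lemma yang_baxter_A2:
  assumes pair: "rank_two_pair \<alpha> \<beta> 1 1" and roots: "\<alpha> \<in> P" "\<beta> \<in> P"
  shows "satisfies_yang_baxter (root_reflection \<alpha>) (root_reflection \<beta>) \<and>
    satisfies_yang_baxter (root_reflection \<beta>) (root_reflection \<alpha>)"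
proof -
  define \<rho> where "\<rho> i = ([1, 1, 0] ! (i - 1)) *\<^sub>R \<alpha> + ([0, 1, 1] ! (i - 1)) *\<^sub>R \<beta>" for i
  have roots2: "rank_two_roots \<alpha> \<beta> 3 \<rho>"
    using rank_two_A2[OF pair] by (simp add: \<rho>_def[abs_def])
  have mem: "\<rho> i \<in> P" if "i \<in> {1..3}" for i
  proof -
    have "i \<in> {1, 2, 3}" using that by (simp, arith)
    then have "[1, 1, 0] ! (i - 1) \<ge> (0 :: real)" "[0, 1, 1] ! (i - 1) \<ge> (0 :: real)" by auto
    then show ?thesis by (rule rank_two_root_P[OF roots2 roots that \<rho>_def])
  qed
  have sums: "\<rho> 2 = \<rho> 1 + \<rho> 3"
    unfolding \<rho>_def scaleR_combination_add by simp_all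
  have Es: "E1 (\<rho> 2) = E1 (\<rho> 1) * E1 (\<rho> 3)"
    "E2 (\<rho> 2) = E2 (\<rho> 1) * E2 (\<rho> 3)"
    using E_sum[OF sums] mem
    by simp_all
  have \<kappa>s: "\<kappa> (root_reflection (\<rho> 3)) = \<kappa> (root_reflection (\<rho> 1))"
    by (rule \<kappa>_shift[OF roots2]; simp add: mem)+
  interpret rank_two_pair \<alpha> \<beta> 1 1 by fact
  \<comment> \<open>Equal Cartan integers force equal lengths, so \<open>\<kappa>\<close> is constant on the three roots.\<close>
  have "\<alpha> \<bullet> \<alpha> = \<beta> \<bullet> \<beta>"
    using cartan nonzero by (simp add: field_simps inner_commute)
  then have "norm (\<rho> 2) = norm (\<rho> 1)"
    using roots2 by (simp add: rank_two_roots_def norm_eq_sqrt_inner inner_root_reflection)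
  then have \<kappa>1: "\<kappa> (root_reflection (\<rho> 2)) = \<kappa> (root_reflection (\<rho> 1))"
    using mem by (intro \<kappa>) auto
  show ?thesis
  proof (rule rank_two_yang_baxter[OF roots2 roots(2) mem])
    fix t F j
    assume j: "j < 2 * (3 :: nat)"
    show "foldr (chamber_op 3 (\<lambda>i. t * p (root_reflection (\<rho> i))) (\<lambda>i. t * q (root_reflection (\<rho> i)))) [1..<Suc 3] F j =
      foldr (chamber_op 3 (\<lambda>i. t * p (root_reflection (\<rho> i))) (\<lambda>i. t * q (root_reflection (\<rho> i)))) (rev [1..<Suc 3]) F j"
      unfolding upt_1_to rev.simps append.simps
      by (rule chamber_op_A2[where A = "\<lambda>i. E1 (\<rho> i)" and B = "\<lambda>i. E2 (\<rho> i)"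
            and \<kappa> = "\<lambda>i. t * \<kappa> (root_reflection (\<rho> i))"])
        (use j in \<open>simp_all only: mem p q E_neq \<kappa>1 \<kappa>s Es times_divide_eq_right mult.assoc not_False_eq_True\<close>)
  qed
qed

lemma yang_baxter_B2:
  assumes pair: "rank_two_pair \<alpha> \<beta> 2 1" and roots: "\<alpha> \<in> P" "\<beta> \<in> P"
  shows "satisfies_yang_baxter (root_reflection \<alpha>) (root_reflection \<beta>) \<and>
    satisfies_yang_baxter (root_reflection \<beta>) (root_reflection \<alpha>)"
proof -
  define \<rho> where "\<rho> i = ([1, 2, 1, 0] ! (i - 1)) *\<^sub>R \<alpha> + ([0, 1, 1, 1] ! (i - 1)) *\<^sub>R \<beta>" for i
  have roots2: "rank_two_roots \<alpha> \<beta> 4 \<rho>"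
    using rank_two_B2[OF pair] by (simp add: \<rho>_def[abs_def])
  have mem: "\<rho> i \<in> P" if "i \<in> {1..4}" for i
  proof -
    have "i \<in> {1, 2, 3, 4}" using that by (simp, arith)
    then have "[1, 2, 1, 0] ! (i - 1) \<ge> (0 :: real)" "[0, 1, 1, 1] ! (i - 1) \<ge> (0 :: real)" by auto
    then show ?thesis by (rule rank_two_root_P[OF roots2 roots that \<rho>_def])
  qed
  have sums: "\<rho> 2 = \<rho> 1 + \<rho> 3" "\<rho> 3 = \<rho> 1 + \<rho> 4"
    unfolding \<rho>_def scaleR_combination_add by simp_all
  have Es: "E1 (\<rho> 2) = E1 (\<rho> 1) * E1 (\<rho> 3)" "E1 (\<rho> 3) = E1 (\<rho> 1) * E1 (\<rho> 4)"
    "E2 (\<rho> 2) = E2 (\<rho> 1) * E2 (\<rho> 3)" "E2 (\<rho> 3) = E2 (\<rho> 1) * E2 (\<rho> 4)"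
    using E_sum[OF sums(1)] E_sum[OF sums(2)] mem
    by simp_all
  have \<kappa>s: "\<kappa> (root_reflection (\<rho> 3)) = \<kappa> (root_reflection (\<rho> 1))"
    "\<kappa> (root_reflection (\<rho> 4)) = \<kappa> (root_reflection (\<rho> 2))"
    by (rule \<kappa>_shift[OF roots2]; simp add: mem)+
  show ?thesis
  proof (rule rank_two_yang_baxter[OF roots2 roots(2) mem])
    fix t F j
    assume j: "j < 2 * (4 :: nat)"
    show "foldr (chamber_op 4 (\<lambda>i. t * p (root_reflection (\<rho> i))) (\<lambda>i. t * q (root_reflection (\<rho> i)))) [1..<Suc 4] F j =
      foldr (chamber_op 4 (\<lambda>i. t * p (root_reflection (\<rho> i))) (\<lambda>i. t * q (root_reflection (\<rho> i)))) (rev [1..<Suc 4]) F j"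
      unfolding upt_1_to rev.simps append.simps
      by (rule chamber_op_B2[where A = "\<lambda>i. E1 (\<rho> i)" and B = "\<lambda>i. E2 (\<rho> i)"
            and \<kappa> = "\<lambda>i. t * \<kappa> (root_reflection (\<rho> i))"])
        (use j in \<open>simp_all only: mem p q E_neq \<kappa>s Es times_divide_eq_right mult.assoc not_False_eq_True\<close>)
  qed
qed

lemma yang_baxter_G2:
  assumes pair: "rank_two_pair \<alpha> \<beta> 3 1" and roots: "\<alpha> \<in> P" "\<beta> \<in> P"
  shows "satisfies_yang_baxter (root_reflection \<alpha>) (root_reflection \<beta>) \<and>
    satisfies_yang_baxter (root_reflection \<beta>) (root_reflection \<alpha>)"
proof -
  define \<rho> where "\<rho> i = ([1, 3, 2, 3, 1, 0] ! (i - 1)) *\<^sub>R \<alpha> + ([0, 1, 1, 2, 1, 1] ! (i - 1)) *\<^sub>R \<beta>" for i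
  have roots2: "rank_two_roots \<alpha> \<beta> 6 \<rho>"
    using rank_two_G2[OF pair] by (simp add: \<rho>_def[abs_def])
  have mem: "\<rho> i \<in> P" if "i \<in> {1..6}" for i
  proof -
    have "i \<in> {1, 2, 3, 4, 5, 6}" using that by (simp, arith)
    then have "[1, 3, 2, 3, 1, 0] ! (i - 1) \<ge> (0 :: real)" "[0, 1, 1, 2, 1, 1] ! (i - 1) \<ge> (0 :: real)" by auto
    then show ?thesis by (rule rank_two_root_P[OF roots2 roots that \<rho>_def])
  qed
  have sums: "\<rho> 2 = \<rho> 1 + \<rho> 3" "\<rho> 3 = \<rho> 1 + \<rho> 5" "\<rho> 4 = \<rho> 3 + \<rho> 5" "\<rho> 5 = \<rho> 1 + \<rho> 6"
    unfolding \<rho>_def scaleR_combination_add by simp_all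
  have Es: "E1 (\<rho> 2) = E1 (\<rho> 1) * E1 (\<rho> 3)" "E1 (\<rho> 3) = E1 (\<rho> 1) * E1 (\<rho> 5)"
    "E1 (\<rho> 4) = E1 (\<rho> 3) * E1 (\<rho> 5)" "E1 (\<rho> 5) = E1 (\<rho> 1) * E1 (\<rho> 6)"
    "E2 (\<rho> 2) = E2 (\<rho> 1) * E2 (\<rho> 3)" "E2 (\<rho> 3) = E2 (\<rho> 1) * E2 (\<rho> 5)" "E2 (\<rho> 4) = E2 (\<rho> 3) * E2 (\<rho> 5)" "E2 (\<rho> 5) = E2 (\<rho> 1) * E2 (\<rho> 6)"
    using E_sum[OF sums(1)] E_sum[OF sums(2)] E_sum[OF sums(3)] E_sum[OF sums(4)] mem
    by simp_all
  have \<kappa>s: "\<kappa> (root_reflection (\<rho> 3)) = \<kappa> (root_reflection (\<rho> 1))"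
    "\<kappa> (root_reflection (\<rho> 5)) = \<kappa> (root_reflection (\<rho> 3))"
    "\<kappa> (root_reflection (\<rho> 4)) = \<kappa> (root_reflection (\<rho> 2))"
    "\<kappa> (root_reflection (\<rho> 6)) = \<kappa> (root_reflection (\<rho> 4))"
    by (rule \<kappa>_shift[OF roots2]; simp add: mem)+
  show ?thesis
  proof (rule rank_two_yang_baxter[OF roots2 roots(2) mem])
    fix t F j
    assume j: "j < 2 * (6 :: nat)"
    show "foldr (chamber_op 6 (\<lambda>i. t * p (root_reflection (\<rho> i))) (\<lambda>i. t * q (root_reflection (\<rho> i)))) [1..<Suc 6] F j =
      foldr (chamber_op 6 (\<lambda>i. t * p (root_reflection (\<rho> i))) (\<lambda>i. t * q (root_reflection (\<rho> i)))) (rev [1..<Suc 6]) F j"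
      unfolding upt_1_to rev.simps append.simps
      by (rule chamber_op_G2[where A = "\<lambda>i. E1 (\<rho> i)" and B = "\<lambda>i. E2 (\<rho> i)"
            and \<kappa> = "\<lambda>i. t * \<kappa> (root_reflection (\<rho> i))"])
        (use j in \<open>simp_all only: mem p q E_neq \<kappa>s Es times_divide_eq_right mult.assoc not_False_eq_True\<close>)
  qed
qed

text \<open>Cartan integers at an obtuse angle are nonpositive with product at most three, so one of them is
  \<open>0\<close> or \<open>- 1\<close> and, up to the order of the two roots, only four types are left.\<close>

lemma obtuse_yang_baxter:
  assumes roots: "\<alpha> \<in> P" "\<beta> \<in> P" "\<alpha> \<noteq> \<beta>" "\<alpha> \<bullet> \<beta> \<le> 0"
  shows "satisfies_yang_baxter (root_reflection \<alpha>) (root_reflection \<beta>)"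
proof -
  have mem: "\<alpha> \<in> \<Phi>" "\<beta> \<in> \<Phi>" using roots P_\<Phi> by auto
  have pos: "\<alpha> \<bullet> \<alpha> > 0" "\<beta> \<bullet> \<beta> > 0" using root_system_nonzero[OF \<Phi>] mem by auto
  obtain n n' where n: "2 * (\<beta> \<bullet> \<alpha>) / (\<alpha> \<bullet> \<alpha>) = of_int n" and n': "2 * (\<alpha> \<bullet> \<beta>) / (\<beta> \<bullet> \<beta>) = of_int n'"
    using root_system_cartan_int[OF \<Phi>] mem by meson
  have prod: "n * n' \<le> 3"
    using root_system_cartan_product[OF \<Phi> mem _ _ n n'] roots uminus_notin_P by blast
  have "real_of_int n \<le> 0" "real_of_int n' \<le> 0"
    unfolding n[symmetric] n'[symmetric] using roots(4) pos
    by (simp_all add: divide_nonpos_pos inner_commute)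
  then have neg: "n \<le> 0" "n' \<le> 0" by simp_all
  have zero: "n = 0 \<longleftrightarrow> n' = 0"
  proof -
    have "real_of_int n = 0 \<longleftrightarrow> real_of_int n' = 0"
      unfolding n[symmetric] n'[symmetric] using pos by (simp add: inner_commute)
    then show ?thesis by simp
  qed
  have "n' = - of_bool (n \<noteq> 0) \<and> n \<in> {0, -1, -2, -3} \<or> n = - of_bool (n' \<noteq> 0) \<and> n' \<in> {0, -1, -2, -3}"
  proof (cases "n = 0")
    case False
    define k k' where "k = - n" and "k' = - n'"
    have k: "k \<ge> 1" "k' \<ge> 1" "k * k' \<le> 3" using False zero neg prod by (simp_all add: k_def k'_def)
    have "k = 1 \<or> k' = 1"
    proof (rule ccontr)
      assume "\<not> (k = 1 \<or> k' = 1)"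
      then have "2 * 2 \<le> k * k'" using k by (intro mult_mono) auto
      then show False using k by simp
    qed
    then show ?thesis using k False zero by (auto simp: k_def k'_def)
  qed (use zero in simp)
  moreover have "\<exists>y. 0 < y \<bullet> \<alpha> \<and> 0 < y \<bullet> \<beta>" using P_pos roots by blast
  then have "rank_two_pair \<alpha> \<beta> (- of_int n) (- of_int n')" "rank_two_pair \<beta> \<alpha> (- of_int n') (- of_int n)"
    using n n' pos by (auto simp: rank_two_pair_def)
  ultimately show ?thesis
    using yang_baxter_A1A1[of \<alpha> \<beta>] yang_baxter_A2[of \<alpha> \<beta>] yang_baxter_B2[of \<alpha> \<beta>] yang_baxter_G2[of \<alpha> \<beta>]
      yang_baxter_B2[of \<beta> \<alpha>] yang_baxter_G2[of \<beta> \<alpha>] roots zero by auto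
qed

end

theorem theorem3p3:
  fixes \<Phi> P :: "'v::euclidean_space set"
    and E1 E2 :: "'v \<Rightarrow> 'k::field_char_0"
    and \<kappa> p q :: "('v \<Rightarrow> 'v) \<Rightarrow> 'k"
  assumes "root_system \<Phi>"
    and "positive_system \<Phi> P"
    and "multiplicative_on P E1"
    and "multiplicative_on P E2"
    and "\<And>\<alpha>. \<alpha> \<in> P \<Longrightarrow> E1 \<alpha> \<noteq> E2 \<alpha>"
    and "\<And>\<sigma> \<tau>. \<sigma> \<in> reflections \<Phi> P \<Longrightarrow> \<tau> \<in> reflections \<Phi> P \<Longrightarrow>
           norm (pos_root P \<sigma>) = norm (pos_root P \<tau>) \<Longrightarrow> \<kappa> \<sigma> = \<kappa> \<tau>"
    and "\<And>\<tau>. \<tau> \<in> reflections \<Phi> P \<Longrightarrow>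
           p \<tau> = \<kappa> \<tau> * E1 (pos_root P \<tau>) / (E1 (pos_root P \<tau>) - E2 (pos_root P \<tau>))"
    and "\<And>\<tau>. \<tau> \<in> reflections \<Phi> P \<Longrightarrow>
           q \<tau> = \<kappa> \<tau> * E2 (pos_root P \<tau>) / (E1 (pos_root P \<tau>) - E2 (pos_root P \<tau>))"
  shows "yang_baxter (End_monoid (weyl_group \<Phi>)) \<Phi> P (mixed_R \<Phi> P p q)"
proof -
  obtain \<gamma> where "\<forall>\<alpha>\<in>\<Phi>. \<gamma> \<bullet> \<alpha> \<noteq> 0" "P = {\<alpha>\<in>\<Phi>. \<gamma> \<bullet> \<alpha> > 0}"
    using assms(2) by (auto simp: positive_system_def)
  then interpret positive_roots \<Phi> P \<gamma>
    using assms(1) by unfold_locales auto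
  have refl: "root_reflection \<alpha> \<in> reflections \<Phi> P" if "\<alpha> \<in> P" for \<alpha>
    using that by (simp add: reflections_eq)
  have "\<kappa> (root_reflection \<alpha>) = \<kappa> (root_reflection \<beta>)"
    if "\<alpha> \<in> P" "\<beta> \<in> P" "norm \<alpha> = norm \<beta>" for \<alpha> \<beta>
    using that by (intro assms(6) refl) (simp_all add: pos_root_reflection)
  moreover have "p (root_reflection \<alpha>) = \<kappa> (root_reflection \<alpha>) * E1 \<alpha> / (E1 \<alpha> - E2 \<alpha>)"
    "q (root_reflection \<alpha>) = \<kappa> (root_reflection \<alpha>) * E2 \<alpha> / (E1 \<alpha> - E2 \<alpha>)" if "\<alpha> \<in> P" for \<alpha>
    using assms(7,8)[OF refl[OF that]] by (simp_all only: pos_root_reflection[OF that])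
  ultimately interpret mixed_weights \<Phi> P \<gamma> E1 E2 \<kappa> p q
    using assms(3-5) by unfold_locales blast+
  show ?thesis
    unfolding yang_baxter_def
  proof (intro conjI ballI allI impI)
    fix \<tau> assume "\<tau> \<in> reflections \<Phi> P"
    then show "mixed_R \<Phi> P p q \<tau> \<in> carrier (End_monoid (weyl_group \<Phi>))"
      using mixed_R_carrier by (auto simp: reflections_eq)
  next
    fix W' a b
    assume *: "dihedral_reflection_subgroup \<Phi> P W' \<and> canonical_generators \<Phi> P W' = {a, b}"
    then obtain X where "X \<subseteq> reflections \<Phi> P" "W' = generate GV X"
      by (auto simp: dihedral_reflection_subgroup_def reflection_subgroup_def)
    then have "subgroup W' GV"
      by (auto simp: reflections_eq GV_carrier intro!: group.generate_is_subgroup[OF group_GV])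
    then interpret sub: positive_roots "root_subsystem \<Phi> W'" "root_subsystem \<Phi> W' \<inter> P" \<gamma>
      by (rule root_subsystem_positive_roots)
    have gen: "root_reflection ` simple_roots (root_subsystem \<Phi> W' \<inter> P) = {a, b}"
      using * by (simp add: canonical_generators_def)
    then have "a \<in> root_reflection ` simple_roots (root_subsystem \<Phi> W' \<inter> P)"
      "b \<in> root_reflection ` simple_roots (root_subsystem \<Phi> W' \<inter> P)" by simp_all
    then obtain \<alpha> \<beta> where simple: "\<alpha> \<in> simple_roots (root_subsystem \<Phi> W' \<inter> P)"
        "\<beta> \<in> simple_roots (root_subsystem \<Phi> W' \<inter> P)" and ab: "a = root_reflection \<alpha>" "b = root_reflection \<beta>"
      by (elim imageE) blast
    have "a \<noteq> b" using * by (auto simp: dihedral_reflection_subgroup_def)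
    then have "\<alpha> \<noteq> \<beta>" using ab by auto
    then have "satisfies_yang_baxter a b"
      unfolding ab using simple sub.simple_P sub.simple_obtuse by (intro obtuse_yang_baxter) auto
    then show "mprod (End_monoid (weyl_group \<Phi>)) (map (mixed_R \<Phi> P p q) (dihedral_reflections a b)) =
        mprod (End_monoid (weyl_group \<Phi>)) (map (mixed_R \<Phi> P p q) (rev (dihedral_reflections a b)))"
      by (simp add: satisfies_yang_baxter_def)
  qed
qed

end
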